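(* Let $m\ge 2$ and let $\tilde\mu$ be the shift-invariant probability $(\mu_1\times\mu_2)\circ F^{-1}$ on the two-sided $m$-Dyck shift $(X,T)$. Then $$h_{\tilde\mu}(X,T)=\log(2)+\frac12\log(m).$$
   Context: Let $\Sigma=\{\alpha_1,\ldots,\alpha_m\}\cup\{\beta_1,\ldots,\beta_m\}$. The Dyck monoid $M$ is the monoid with zero $0$ and identity $1$ (the empty word), generated by $\alpha_i,\beta_i$ ($1\le i\le m$) with relations $\alpha_j\beta_j\equiv 1$ and $\alpha_i\beta_j\equiv 0$ for $i\ne j$. Let $L=\{l\in\Sigma^*: l\not\equiv 0 \text{ (mod } M)\}$ and $X=\{x\in\Sigma^{\mathbb Z}: x_r\cdots x_l\in L \text{ for all } r\le l\}$ (the two-sided $m$-Dyck shift), with shift map $(Tx)_n=x_{n+1}$. For $z\in\{0,1\}^{\mathbb Z}$ put $\tilde H_0(z)=0$, $\tilde H_i(z)=\sum_{j=0}^{i-1}(\delta_{1,z_j}-\delta_{0,z_j})$ for $i>0$ and $\tilde H_i(z)=\sum_{j=i}^{-1}(\delta_{0,z_j}-\delta_{1,z_j})$ for $i<0$. Let $S_{-\infty}^{-\infty}=\{z\in\{0,1\}^{\mathbb Z}: \liminf_{n\to+\infty}\tilde H_n(z)=-\infty,\ \liminf_{n\to-\infty}\tilde H_n(z)=-\infty\}$. Define $\gamma_k(z)=\sum_{i=0}^k z_i$ for $k\ge 0$, $\gamma_k(z)=-\sum_{i=k}^{-1}z_i$ for $k<0$, and $\varepsilon_n(z)=\max\{l<n: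 \tilde H_l(z)\le\tilde H_{n+1}(z)\}$. Define the Borel function $F:S_{-\infty}^{-\infty}\times\{1,\ldots,m\}^{\mathbb Z}\to\Sigma^{\mathbb Z}$ by: $F(z,a)_n=\alpha_j$ if $z_n=1$ and $a_{\gamma_n(z)}=j$; $F(z,a)_n=\beta_j$ if $z_n=0$ and $a_{\gamma_k(z)}=j$ where $k=\varepsilon_n(z)$. $F$ takes values in $X$. Let $\mu_1$ and $\mu_2$ be the symmetric (uniform i.i.d.) product measures on $\{0,1\}^{\mathbb Z}$ and $\{1,\ldots,m\}^{\mathbb Z}$; then $\mu_1(S_{-\infty}^{-\infty})=1$, and $\tilde\mu=(\mu_1\times\mu_2)\circ F^{-1}$ is a Borel probability on $X$, which is $T$-invariant. $h_{\tilde\mu}(X,T)$ denotes the measure-theoretic (Kolmogorov–Sinai) entropy. *)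

theory Defs
  imports "HOL-Probability.Probability"
begin

section \<open>Kolmogorov--Sinai entropy\<close>

definition finite_measurable_partition :: "'a measure \<Rightarrow> 'a set set \<Rightarrow> bool" where
  "finite_measurable_partition M P \<longleftrightarrow> finite P \<and> P \<subseteq> sets M \<and> partition_on (space M) P"

text \<open>Natural logarithm; the convention \<open>0 log 0 = 0\<close> holds because the factor in front vanishes.\<close>
definition partition_entropy :: "'a measure \<Rightarrow> 'a set set \<Rightarrow> real" where
  "partition_entropy M P = - (\<Sum>A\<in>P. measure M A * ln (measure M A))"

text \<open>The join of the partitions \<open>T\<^sup>-\<^sup>i P\<close> for \<open>0 \<le> i < n\<close>.\<close>
definition iterated_join :: "'a measure \<Rightarrow> ('a \<Rightarrow> 'a) \<Rightarrow> 'a set set \<Rightarrow> nat \<Rightarrow> 'a set set" where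
  "iterated_join M T P n =
     {space M \<inter> (\<Inter>i<n. (T ^^ i) -` A i) | A. \<forall>i<n. A i \<in> P} - {{}}"

definition entropy_wrt_partition :: "'a measure \<Rightarrow> ('a \<Rightarrow> 'a) \<Rightarrow> 'a set set \<Rightarrow> real" where
  "entropy_wrt_partition M T P =
     lim (\<lambda>n. partition_entropy M (iterated_join M T P n) / real n)"

text \<open>The limit above exists whenever \<open>T\<close> preserves the probability measure \<open>M\<close>; the
  supremum may be infinite, hence the type \<open>ereal\<close>.\<close>
definition ks_entropy :: "'a measure \<Rightarrow> ('a \<Rightarrow> 'a) \<Rightarrow> ereal" where
  "ks_entropy M T =
     (SUP P\<in>{P. finite_measurable_partition M P}. ereal (entropy_wrt_partition M T P))"


section \<open>The Dyck monoid and the two-sided Dyck shift\<close>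

datatype letter = Alpha nat | Beta nat

definition alphabet :: "nat \<Rightarrow> letter set" where
  "alphabet m = Alpha ` {1..m} \<union> Beta ` {1..m}"

text \<open>The free monoid with zero over the alphabet: \<open>None\<close> is the zero \<open>0\<close> and \<open>Some []\<close> the
  identity \<open>1\<close>.\<close>
definition free_monoid0 :: "nat \<Rightarrow> letter list option set" where
  "free_monoid0 m = insert None (Some ` lists (alphabet m))"

fun mult0 :: "'a list option \<Rightarrow> 'a list option \<Rightarrow> 'a list option" where
  "mult0 (Some u) (Some v) = Some (u @ v)"
| "mult0 _ _ = None"

text \<open>The congruence on the free monoid with zero generated by the defining relations; the Dyck
  monoid is the quotient by it.\<close>
inductive dyck_cong :: "nat \<Rightarrow> letter list option \<Rightarrow> letter list option \<Rightarrow> bool" for m where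
  cancel: "j \<in> {1..m} \<Longrightarrow> dyck_cong m (Some [Alpha j, Beta j]) (Some [])"
| clash: "i \<in> {1..m} \<Longrightarrow> j \<in> {1..m} \<Longrightarrow> i \<noteq> j \<Longrightarrow> dyck_cong m (Some [Alpha i, Beta j]) None"
| refl: "u \<in> free_monoid0 m \<Longrightarrow> dyck_cong m u u"
| sym: "dyck_cong m u v \<Longrightarrow> dyck_cong m v u"
| trans: "dyck_cong m u v \<Longrightarrow> dyck_cong m v w \<Longrightarrow> dyck_cong m u w"
| left: "dyck_cong m u v \<Longrightarrow> w \<in> free_monoid0 m \<Longrightarrow> dyck_cong m (mult0 w u) (mult0 w v)"
| right: "dyck_cong m u v \<Longrightarrow> w \<in> free_monoid0 m \<Longrightarrow> dyck_cong m (mult0 u w) (mult0 v w)"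

definition dyck_language :: "nat \<Rightarrow> letter list set" where
  "dyck_language m = {l \<in> lists (alphabet m). \<not> dyck_cong m (Some l) None}"

definition dyck_shift :: "nat \<Rightarrow> (int \<Rightarrow> letter) set" where
  "dyck_shift m = {x. (\<forall>n. x n \<in> alphabet m) \<and> (\<forall>r l. r \<le> l \<longrightarrow> map x [r..l] \<in> dyck_language m)}"

definition seq_shift :: "(int \<Rightarrow> 'a) \<Rightarrow> int \<Rightarrow> 'a" where
  "seq_shift x = (\<lambda>n. x (n + 1))"

definition dyck_space :: "nat \<Rightarrow> (int \<Rightarrow> letter) measure" where
  "dyck_space m = restrict_space (PiM UNIV (\<lambda>_. count_space (alphabet m))) (dyck_shift m)"


section \<open>The coding map and the measure\<close>

definition height :: "(int \<Rightarrow> int) \<Rightarrow> int \<Rightarrow> int" where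
  "height z i =
     (if i \<ge> 0 then \<Sum>j\<in>{0..i - 1}. of_bool (z j = 1) - of_bool (z j = 0)
      else \<Sum>j\<in>{i..-1}. of_bool (z j = 0) - of_bool (z j = 1))"

text \<open>The set \<open>S\<close> of sequences whose height has lower limit \<open>-\<infinity>\<close> in both directions.\<close>
definition S_inf :: "(int \<Rightarrow> int) set" where
  "S_inf = {z. (\<forall>n. z n \<in> {0, 1})
     \<and> Liminf at_top (\<lambda>n. ereal (of_int (height z n))) = -\<infinity>
     \<and> Liminf at_bot (\<lambda>n. ereal (of_int (height z n))) = -\<infinity>}"

definition gam :: "(int \<Rightarrow> int) \<Rightarrow> int \<Rightarrow> int" where
  "gam z k = (if k \<ge> 0 then \<Sum>i\<in>{0..k}. z i else - (\<Sum>i\<in>{k..-1}. z i))"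

definition eps :: "(int \<Rightarrow> int) \<Rightarrow> int \<Rightarrow> int" where
  "eps z n = (GREATEST l. l < n \<and> height z l \<le> height z (n + 1))"

text \<open>Meaningful for \<open>z \<in> S_inf\<close> only, where the maximum defining \<open>eps\<close> exists.\<close>
definition dyck_code :: "(int \<Rightarrow> int) \<times> (int \<Rightarrow> nat) \<Rightarrow> int \<Rightarrow> letter" where
  "dyck_code = (\<lambda>(z, a) n. if z n = 1 then Alpha (a (gam z n)) else Beta (a (gam z (eps z n))))"

definition mu1 :: "(int \<Rightarrow> int) measure" where
  "mu1 = PiM UNIV (\<lambda>_. uniform_count_measure {0, 1})"

definition mu2 :: "nat \<Rightarrow> (int \<Rightarrow> nat) measure" where
  "mu2 m = PiM UNIV (\<lambda>_. uniform_count_measure {1..m})"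

text \<open>The product measure is restricted to the domain of the coding map, which has full
  measure.\<close>
definition mu_tilde :: "nat \<Rightarrow> (int \<Rightarrow> letter) measure" where
  "mu_tilde m =
     distr (restrict_space (mu1 \<Otimes>\<^sub>M mu2 m) (S_inf \<times> space (mu2 m))) (dyck_space m) dyck_code"

end

(* Given the bits z, the letters of a block of length n are determined by the labels of the distinct
   positions to which its letters are matched. There are cells = n - (matched pairs inside the block)
   of them, and they are independent and uniform, so every word that occurs has probability
   2^-n * m^-cells. Since cells = (number of beta) + (number of alpha still open at the end), and the
   latter is a random walk reflected at 0 with mean at most sqrt n, the block entropy is
   n ln 2 + (n/2 + O(sqrt n)) ln m. The upper bound for an arbitrary partition P compares the
   P-itinerary with blocks via Gibbs' inequality, using a block-measurable approximation of P. *)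

theory Submission imports Defs "HOL-Real_Asymp.Real_Asymp" begin

section \<open>Entropy of finite-valued random variables\<close>

text \<open>A label may be read from arbitrarily far to the left, so a block of
  \<open>dyck_code\<close> is not a function of any fixed block of (z, a). The computation goes
  through because only the coincidence pattern of the label positions matters, and the bits inside
  the block determine that pattern (\<open>partner_eq_transfer\<close>). Hence the probability of a
  word does not depend on its position, which yields shift invariance, and if positive its logarithm
  is a function of the bits alone. Recurrence of the fair walk enters because the coding space is
  restricted to \<open>S_inf\<close>: only with full measure is \<open>mu_tilde\<close> a
  probability. On the entropy side the obstacle is the supremum over all finite partitions.
  Entropies are those of functions, written as integrals of the information function, so that the
  cost of a guessed law is an integral of the same shape. Conditional entropies appear only through
  such costs.\<close>

definition rv_entropy :: "'a measure \<Rightarrow> ('a \<Rightarrow> 'b) \<Rightarrow> real" where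
  "rv_entropy M X = - (\<integral>x. ln (measure M {y \<in> space M. X y = X x}) \<partial>M)"

lemma simple_function_fibre_sets:
  assumes "simple_function M X"
  shows "{x \<in> space M. X x = v} \<in> sets M"
proof -
  have "{x \<in> space M. X x = v} = X -` {v} \<inter> space M" by auto
  with simple_functionD(2)[OF assms, of "{v}"] show ?thesis by simp
qed

lemma simple_function_compose_measurable:
  assumes X: "simple_function M X" and T: "T \<in> measurable M M"
  shows "simple_function M (\<lambda>x. X (T x))"
  unfolding simple_function_def
proof (intro conjI ballI)
  show "finite ((\<lambda>x. X (T x)) ` space M)"
    by (rule finite_subset[OF _ simple_functionD(1)[OF X]]) (use measurable_space[OF T] in auto)
next
  fix v
  have "(\<lambda>x. X (T x)) -` {v} \<inter> space M = T -` {y \<in> space M. X y = v} \<inter> space M"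
    using measurable_space[OF T] by auto
  then show "(\<lambda>x. X (T x)) -` {v} \<inter> space M \<in> sets M"
    using measurable_sets[OF T simple_function_fibre_sets[OF X, of v]] by simp
qed

context prob_space
begin

text \<open>The finitely many fibres of probability zero form a null set. This lets the rules for
  \<open>ln\<close> be applied almost everywhere to positive numbers.\<close>

lemma simple_function_pos_prob:
  assumes X: "simple_function M X"
  shows "AE x in M. prob {y \<in> space M. X y = X x} > 0"
proof -
  have "AE x in M. \<forall>v\<in>X ` space M. prob {y \<in> space M. X y = v} = 0 \<longrightarrow> X x \<noteq> v"
  proof (rule AE_finite_allI[OF simple_functionD(1)[OF X]])
    fix v
    show "AE x in M. prob {y \<in> space M. X y = v} = 0 \<longrightarrow> X x \<noteq> v"
    proof (cases "prob {y \<in> space M. X y = v} = 0")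
      case True
      then have "{y \<in> space M. X y = v} \<in> null_sets M"
        using simple_function_fibre_sets[OF X, of v] by (simp add: emeasure_eq_measure null_setsI)
      from AE_not_in[OF this] show ?thesis by (rule AE_mp) (auto intro!: AE_I2)
    qed simp
  qed
  then show ?thesis
  proof (rule AE_mp, intro AE_I2 impI)
    fix x assume "x \<in> space M" and "\<forall>v\<in>X ` space M. prob {y \<in> space M. X y = v} = 0 \<longrightarrow> X x \<noteq> v"
    then have "prob {y \<in> space M. X y = X x} \<noteq> 0" by blast
    then show "prob {y \<in> space M. X y = X x} > 0" using measure_nonneg[of M] by (simp add: less_le)
  qed
qed

lemma simple_function_integral:
  fixes g :: "'b \<Rightarrow> real"
  assumes X: "simple_function M X"
  shows integrable_simple: "integrable M (\<lambda>x. g (X x))"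
    and integral_simple: "(\<integral>x. g (X x) \<partial>M) = (\<Sum>v\<in>X ` space M. g v * prob {x \<in> space M. X x = v})"
proof -
  let ?S = "\<lambda>x. \<Sum>v\<in>X ` space M. g v * indicator {y \<in> space M. X y = v} x"
  have fin: "finite (X ` space M)" using simple_functionD(1)[OF X] .
  have eq: "g (X x) = ?S x" if "x \<in> space M" for x
  proof -
    have "?S x = (\<Sum>v\<in>X ` space M. if v = X x then g v else 0)"
      by (rule sum.cong) (use that in \<open>auto simp: indicator_def\<close>)
    also have "\<dots> = g (X x)" using fin that by simp
    finally show ?thesis by simp
  qed
  have int: "integrable M (\<lambda>x. g v * indicator {y \<in> space M. X y = v} x)" for v
    using simple_function_fibre_sets[OF X, of v] by (simp add: emeasure_eq_measure)
  have "integrable M ?S" by (rule Bochner_Integration.integrable_sum) (rule int)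
  then show "integrable M (\<lambda>x. g (X x))"
    by (subst Bochner_Integration.integrable_cong[OF HOL.refl, of M _ ?S]) (simp_all only: eq)
  have "(\<integral>x. g (X x) \<partial>M) = (\<integral>x. ?S x \<partial>M)"
    by (rule Bochner_Integration.integral_cong[OF HOL.refl eq])
  also have "\<dots> = (\<Sum>v\<in>X ` space M. \<integral>x. g v * indicator {y \<in> space M. X y = v} x \<partial>M)"
    by (rule Bochner_Integration.integral_sum) (rule int)
  also have "\<dots> = (\<Sum>v\<in>X ` space M. g v * prob {x \<in> space M. X x = v})"
    by (intro sum.cong HOL.refl) (simp add: Int_absorb2[OF Collect_restrict])
  finally show "(\<integral>x. g (X x) \<partial>M) = (\<Sum>v\<in>X ` space M. g v * prob {x \<in> space M. X x = v})" .
qed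

lemma rv_entropy_eq_sum:
  assumes "simple_function M X"
  shows "rv_entropy M X = - (\<Sum>v\<in>X ` space M. prob {x \<in> space M. X x = v} * ln (prob {x \<in> space M. X x = v}))"
  using integral_simple[OF assms, of "\<lambda>v. ln (prob {y \<in> space M. X y = v})"]
  by (simp add: rv_entropy_def mult.commute)

lemma sum_prob_fibres:
  assumes X: "simple_function M X"
  shows "(\<Sum>v\<in>X ` space M. prob {x \<in> space M. X x = v}) = 1"
  using integral_simple[OF assms, of "\<lambda>v. 1"] prob_space by simp

text \<open>\<open>ln t <= t - 1\<close> at t = q/p, weighted by p and summed. Total mass at most 1
  suffices, so \<open>q\<close> may be a law restricted to the range of \<open>X\<close>.\<close>

lemma gibbs_inequality:
  assumes X: "simple_function M X"
    and q0: "\<And>v. q v \<ge> 0" and q1: "(\<Sum>v\<in>X ` space M. q v) \<le> 1"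
    and pos: "\<And>v. prob {x \<in> space M. X x = v} > 0 \<Longrightarrow> q v > 0"
  shows "rv_entropy M X \<le> - (\<integral>x. ln (q (X x)) \<partial>M)"
proof -
  let ?p = "\<lambda>v. prob {x \<in> space M. X x = v}"
  have "(\<Sum>v\<in>X ` space M. ln (q v) * ?p v - ln (?p v) * ?p v) \<le> (\<Sum>v\<in>X ` space M. q v - ?p v)"
  proof (rule sum_mono)
    fix v
    show "ln (q v) * ?p v - ln (?p v) * ?p v \<le> q v - ?p v"
    proof (cases "?p v > 0")
      case True
      then have "ln (q v) - ln (?p v) \<le> q v / ?p v - 1"
        using pos[OF True] ln_le_minus_one[of "q v / ?p v"] by (simp add: ln_div)
      then have "(ln (q v) - ln (?p v)) * ?p v \<le> (q v / ?p v - 1) * ?p v"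
        using True by (intro mult_right_mono) auto
      then show ?thesis using True by (simp add: algebra_simps)
    next
      case False
      then have "?p v = 0" using measure_nonneg[of M] by (simp add: less_le)
      then show ?thesis using q0 by simp
    qed
  qed
  also have "\<dots> \<le> 0" using q1 sum_prob_fibres[OF X] by (simp add: sum_subtractf)
  finally show ?thesis
    unfolding rv_entropy_def integral_simple[OF X, of "\<lambda>v. ln (q v)"]
      integral_simple[OF X, of "\<lambda>v. ln (?p v)"]
    by (simp add: sum_subtractf)
qed

text \<open>Fibres of \<open>Y\<close> contain those of \<open>X\<close>, so the information, minus
  the logarithm of the fibre probability, can only drop.\<close>

lemma rv_entropy_compose_le:
  assumes X: "simple_function M X" and Y: "\<And>x. x \<in> space M \<Longrightarrow> Y x = f (X x)"
  shows "rv_entropy M Y \<le> rv_entropy M X"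
proof -
  let ?p = "\<lambda>v. prob {x \<in> space M. X x = v}" and ?q = "\<lambda>v. prob {x \<in> space M. f (X x) = v}"
  have eq: "{y \<in> space M. Y y = Y x} = {y \<in> space M. f (X y) = f (X x)}" if "x \<in> space M" for x
    using that Y by auto
  have "(\<integral>x. ln (?p (X x)) \<partial>M) \<le> (\<integral>x. ln (?q (f (X x))) \<partial>M)"
  proof (rule integral_mono_AE)
    show "integrable M (\<lambda>x. ln (?p (X x)))" by (rule integrable_simple[OF X])
    show "integrable M (\<lambda>x. ln (?q (f (X x))))"
      by (rule integrable_simple[OF X, of "\<lambda>v. ln (?q (f v))"])
    show "AE x in M. ln (?p (X x)) \<le> ln (?q (f (X x)))"
      using simple_function_pos_prob[OF X]
    proof (rule AE_mp, intro AE_I2 impI)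
      fix x assume "?p (X x) > 0"
      moreover have "?p (X x) \<le> ?q (f (X x))"
        using simple_function_fibre_sets[OF simple_function_compose1[OF X, of f]]
        by (intro finite_measure_mono) auto
      ultimately show "ln (?p (X x)) \<le> ln (?q (f (X x)))" by simp
    qed
  qed
  also have "(\<integral>x. ln (?q (f (X x))) \<partial>M) = (\<integral>x. ln (prob {y \<in> space M. Y y = Y x}) \<partial>M)"
    by (intro Bochner_Integration.integral_cong HOL.refl) (simp only: eq)
  finally show ?thesis by (simp add: rv_entropy_def)
qed

text \<open>The chain rule \<open>H(X, B) = H(B) + H(X | B)\<close>, with the conditional entropy replaced by the cross
  entropy against an arbitrary conditional subprobability \<open>r\<close>.\<close>
lemma rv_entropy_pair_cond:
  assumes X: "simple_function M X" and B: "simple_function M B"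
    and r0: "\<And>v b. r v b \<ge> 0" and r1: "\<And>b. (\<Sum>v\<in>X ` space M. r v b) \<le> 1"
    and pos: "\<And>v b. prob {x \<in> space M. X x = v \<and> B x = b} > 0 \<Longrightarrow> r v b > 0"
  shows "rv_entropy M (\<lambda>x. (X x, B x)) \<le> rv_entropy M B - (\<integral>x. ln (r (X x) (B x)) \<partial>M)"
proof -
  let ?p = "\<lambda>b. prob {x \<in> space M. B x = b}"
  let ?Z = "\<lambda>x. (X x, B x)"
  have Z: "simple_function M ?Z" by (rule simple_function_Pair[OF X B])
  have pos': "?p b > 0 \<and> r v b > 0" if "prob {x \<in> space M. ?Z x = (v, b)} > 0" for v b
  proof -
    have "prob {x \<in> space M. ?Z x = (v, b)} \<le> ?p b"
      using simple_function_fibre_sets[OF B] by (intro finite_measure_mono) auto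
    then show ?thesis using that pos[of v b] by simp
  qed
  \<comment> \<open>Gibbs with the guess P(B = b) * r v b for the joint law. Its logarithm splits
    almost surely, namely where both factors are positive.\<close>
  have "rv_entropy M ?Z \<le> - (\<integral>x. ln ((\<lambda>(v, b). ?p b * r v b) (?Z x)) \<partial>M)"
  proof (rule gibbs_inequality[OF Z])
    show "(\<lambda>(v, b). ?p b * r v b) vb \<ge> 0" for vb
      using r0 by (auto simp: case_prod_beta)
    have "(\<Sum>vb\<in>?Z ` space M. (\<lambda>(v, b). ?p b * r v b) vb)
        \<le> (\<Sum>vb\<in>(X ` space M) \<times> (B ` space M). (\<lambda>(v, b). ?p b * r v b) vb)"
      using simple_functionD(1)[OF X] simple_functionD(1)[OF B] r0
      by (intro sum_mono2) auto
    also have "\<dots> = (\<Sum>b\<in>B ` space M. \<Sum>v\<in>X ` space M. ?p b * r v b)"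
      by (subst sum.cartesian_product[symmetric], subst sum.swap) simp
    also have "\<dots> = (\<Sum>b\<in>B ` space M. ?p b * (\<Sum>v\<in>X ` space M. r v b))"
      by (simp add: sum_distrib_left)
    also have "\<dots> \<le> (\<Sum>b\<in>B ` space M. ?p b * 1)"
      by (intro sum_mono mult_left_mono r1) auto
    also have "\<dots> = 1" using sum_prob_fibres[OF B] by simp
    finally show "(\<Sum>vb\<in>?Z ` space M. (\<lambda>(v, b). ?p b * r v b) vb) \<le> 1" .
    show "(\<lambda>(v, b). ?p b * r v b) vb > 0" if "prob {x \<in> space M. ?Z x = vb} > 0" for vb
      using pos'[of "fst vb" "snd vb"] that by (simp add: case_prod_beta)
  qed
  also have "(\<integral>x. ln ((\<lambda>(v, b). ?p b * r v b) (?Z x)) \<partial>M)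
      = (\<integral>x. ln (?p (B x)) + ln (r (X x) (B x)) \<partial>M)"
  proof (rule integral_cong_AE)
    have "integrable M (\<lambda>x. ln ((\<lambda>(v, b). ?p b * r v b) (?Z x)))"
      by (rule integrable_simple[OF Z, of "\<lambda>z. ln ((\<lambda>(v, b). ?p b * r v b) z)"])
    then show "(\<lambda>x. ln ((\<lambda>(v, b). ?p b * r v b) (?Z x))) \<in> borel_measurable M" by simp
    have "integrable M (\<lambda>x. (\<lambda>(v, b). ln (?p b) + ln (r v b)) (?Z x))"
      by (rule integrable_simple[OF Z])
    then show "(\<lambda>x. ln (?p (B x)) + ln (r (X x) (B x))) \<in> borel_measurable M" by simp
    show "AE x in M. ln ((\<lambda>(v, b). ?p b * r v b) (?Z x)) = ln (?p (B x)) + ln (r (X x) (B x))"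
      using simple_function_pos_prob[OF Z]
    proof (rule AE_mp, intro AE_I2 impI)
      fix x assume "prob {y \<in> space M. ?Z y = ?Z x} > 0"
      from pos'[OF this]
      show "ln ((\<lambda>(v, b). ?p b * r v b) (?Z x)) = ln (?p (B x)) + ln (r (X x) (B x))"
        by (simp add: ln_mult)
    qed
  qed
  also have "\<dots> = (\<integral>x. ln (?p (B x)) \<partial>M) + (\<integral>x. ln (r (X x) (B x)) \<partial>M)"
    using integrable_simple[OF Z, of "\<lambda>(v, b). ln (r v b)"]
      integrable_simple[OF B, of "\<lambda>b. ln (?p b)"]
    by (intro Bochner_Integration.integral_add) simp_all
  finally show ?thesis by (simp add: rv_entropy_def)
qed

text \<open>Instance of the chain rule in which the guess for \<open>X\<close> ignores
  \<open>B\<close> and is the law of \<open>X\<close> itself.\<close>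

lemma rv_entropy_pair_le:
  assumes X: "simple_function M X" and B: "simple_function M B"
  shows "rv_entropy M (\<lambda>x. (X x, B x)) \<le> rv_entropy M X + rv_entropy M B"
proof -
  let ?p = "\<lambda>v. prob {x \<in> space M. X x = v}"
  have "rv_entropy M (\<lambda>x. (X x, B x)) \<le> rv_entropy M B - (\<integral>x. ln ((\<lambda>v b. ?p v) (X x) (B x)) \<partial>M)"
  proof (rule rv_entropy_pair_cond[OF X B])
    fix v b assume *: "prob {x \<in> space M. X x = v \<and> B x = b} > 0"
    have "prob {x \<in> space M. X x = v \<and> B x = b} \<le> ?p v"
      using simple_function_fibre_sets[OF X] by (intro finite_measure_mono) auto
    with * show "?p v > 0" by simp
  qed (simp_all add: sum_prob_fibres[OF X])
  then show ?thesis by (simp add: rv_entropy_def)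
qed

lemma rv_entropy_nonneg:
  assumes X: "simple_function M X"
  shows "rv_entropy M X \<ge> 0"
proof -
  have "(\<integral>x. ln (prob {y \<in> space M. X y = X x}) \<partial>M) \<le> (\<integral>x. 0 \<partial>M)"
  proof (rule integral_mono_AE)
    show "integrable M (\<lambda>x. ln (prob {y \<in> space M. X y = X x}))"
      by (rule integrable_simple[OF X, of "\<lambda>v. ln (prob {y \<in> space M. X y = v})"])
    show "AE x in M. ln (prob {y \<in> space M. X y = X x}) \<le> 0"
      using simple_function_pos_prob[OF X] by (rule AE_mp) (auto intro!: AE_I2 simp: ln_le_zero_iff)
  qed simp
  then show ?thesis by (simp add: rv_entropy_def)
qed

end

section \<open>Itineraries and the generator theorem\<close>

definition itinerary :: "('a \<Rightarrow> 'a) \<Rightarrow> ('a \<Rightarrow> 'b) \<Rightarrow> nat \<Rightarrow> 'a \<Rightarrow> 'b list" where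
  "itinerary T f n x = map (\<lambda>i. f ((T ^^ i) x)) [0..<n]"

definition part_label :: "'a set set \<Rightarrow> 'a \<Rightarrow> 'a set" where
  "part_label P x = (THE A. A \<in> P \<and> x \<in> A)"

lemma part_label_eqI:
  assumes "partition_on S P" "A \<in> P" "x \<in> A"
  shows "part_label P x = A"
  unfolding part_label_def
  using assms(2,3) partition_onD2[OF assms(1), unfolded disjoint_def] by (intro the_equality) blast+

lemma part_label:
  assumes P: "partition_on S P" and x: "x \<in> S"
  shows "part_label P x \<in> P" "x \<in> part_label P x"
proof -
  obtain A where "A \<in> P" "x \<in> A" using partition_onD1[OF P] x by blast
  with part_label_eqI[OF P this] show "part_label P x \<in> P" "x \<in> part_label P x" by simp_all
qed

lemma simple_function_part_label:
  assumes P: "finite_measurable_partition M P"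
  shows "simple_function M (part_label P)"
  unfolding simple_function_def
proof (intro conjI ballI)
  have part: "partition_on (space M) P" and fin: "finite P" and meas: "P \<subseteq> sets M"
    using P by (auto simp: finite_measurable_partition_def)
  show "finite (part_label P ` space M)"
    using part_label[OF part] by (intro finite_subset[OF _ fin]) auto
  fix A assume "A \<in> part_label P ` space M"
  then have A: "A \<in> P" using part_label[OF part] by auto
  have "part_label P -` {A} \<inter> space M = A"
    using part_label[OF part] part_label_eqI[OF part A] A partition_onD1[OF part] by auto
  then show "part_label P -` {A} \<inter> space M \<in> sets M" using A meas by auto
qed

lemma measurable_funpow:
  "T \<in> measurable M M \<Longrightarrow> (T ^^ n) \<in> measurable M M"
  by (induction n) (auto simp: id_def intro: measurable_comp)

lemma distr_funpow:
  assumes "T \<in> measurable M M" "distr M M T = M"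
  shows "distr M M (T ^^ n) = M"
proof (induction n)
  case 0
  then show ?case by (simp add: id_def distr_id)
next
  case (Suc n)
  have "distr M M (T \<circ> T ^^ n) = distr (distr M M (T ^^ n)) M T"
    using assms measurable_funpow by (intro distr_distr[symmetric]) auto
  then show ?case by (simp only: Suc assms funpow.simps)
qed

lemma itinerary_Suc: "itinerary T f (Suc n) x = itinerary T f n x @ [f ((T ^^ n) x)]"
  by (simp add: itinerary_def)

lemma itinerary_add: "itinerary T f (n + k) x = itinerary T f n x @ itinerary T f k ((T ^^ n) x)"
  by (induction k) (simp_all add: itinerary_def, metis add.commute comp_apply funpow_add)

lemma simple_function_itinerary:
  assumes f: "simple_function M f" and T: "T \<in> measurable M M"
  shows "simple_function M (itinerary T f n)"
proof (induction n)
  case 0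
  have "itinerary T f 0 = (\<lambda>x. [])" by (simp add: itinerary_def fun_eq_iff)
  then show ?case by simp
next
  case (Suc n)
  have "simple_function M (\<lambda>x. (\<lambda>(u, v). u @ [v]) (itinerary T f n x, f ((T ^^ n) x)))"
    by (intro simple_function_compose1[where g = "\<lambda>(u, v). u @ [v]"] simple_function_Pair Suc
        simple_function_compose_measurable[OF f] measurable_funpow T)
  then show ?case by (simp add: itinerary_Suc[abs_def])
qed

text \<open>The cells of the join are the nonempty fibres of the itinerary, so both sides are the
  same sum.\<close>

lemma partition_entropy_iterated_join:
  assumes M: "prob_space M" and P: "finite_measurable_partition M P" and T: "T \<in> measurable M M"
  shows "partition_entropy M (iterated_join M T P n) = rv_entropy M (itinerary T (part_label P) n)"
proof -
  interpret prob_space M by fact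
  let ?X = "itinerary T (part_label P) n"
  let ?C = "\<lambda>w. {y \<in> space M. ?X y = w}"
  have part: "partition_on (space M) P" using P by (simp add: finite_measurable_partition_def)
  have Tn: "(T ^^ i) x \<in> space M" if "x \<in> space M" for i x
    using measurable_space[OF measurable_funpow[OF T] that] .
  have fibre: "space M \<inter> (\<Inter>i<n. (T ^^ i) -` A i) = ?C (map A [0..<n])" if "\<forall>i<n. A i \<in> P" for A
    using that part_label[OF part Tn] part_label_eqI[OF part]
    by (auto simp: itinerary_def list_eq_iff_nth_eq) metis
  have eq: "iterated_join M T P n = ?C ` (?X ` space M)"
  proof (intro equalityI subsetI)
    fix D assume "D \<in> iterated_join M T P n"
    then obtain A where A: "\<forall>i<n. A i \<in> P" and D': "D = space M \<inter> (\<Inter>i<n. (T ^^ i) -` A i)" and "D \<noteq> {}"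
      unfolding iterated_join_def by blast
    have D: "D = ?C (map A [0..<n])" unfolding D' by (rule fibre[OF A])
    with \<open>D \<noteq> {}\<close> obtain x where x: "x \<in> space M" "?X x = map A [0..<n]" by blast
    then have "map A [0..<n] \<in> ?X ` space M" by (intro image_eqI[where f = ?X and x = x, OF x(2)[symmetric] x(1)])
    then show "D \<in> ?C ` (?X ` space M)" unfolding D by (rule imageI)
  next
    fix D assume "D \<in> ?C ` (?X ` space M)"
    then obtain x where x: "x \<in> space M" and D: "D = ?C (?X x)" by auto
    let ?A = "\<lambda>i. part_label P ((T ^^ i) x)"
    have A: "\<forall>i<n. ?A i \<in> P" using part_label[OF part Tn[OF x]] by simp
    have "D = space M \<inter> (\<Inter>i<n. (T ^^ i) -` ?A i)"
      unfolding fibre[OF A] D by (simp add: itinerary_def)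
    moreover have "D \<noteq> {}" using D x by auto
    ultimately show "D \<in> iterated_join M T P n"
      unfolding iterated_join_def using A by (intro DiffI CollectI exI[of _ ?A] conjI) simp_all
  qed
  \<comment> \<open>Fibres over attained values are nonempty and so determine the value; the sum
    over cells can be reindexed by itineraries.\<close>
  have inj: "inj_on ?C (?X ` space M)" 
  proof (rule inj_onI)
    fix v w assume "v \<in> ?X ` space M" and eq: "?C v = ?C w"
    then obtain x where "x \<in> space M" "?X x = v" by blast
    then have "x \<in> ?C v" by simp
    then have "x \<in> ?C w" unfolding eq .
    with \<open>?X x = v\<close> show "v = w" by simp
  qed
  show ?thesis
    unfolding partition_entropy_def eq sum.reindex[OF inj]
      rv_entropy_eq_sum[OF simple_function_itinerary[OF simple_function_part_label[OF P] T]]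
    by (simp add: comp_def)
qed

text \<open>\<open>entropy_wrt_partition\<close> is a \<open>lim\<close>, which carries information
  only once convergence is known. Division with remainder compares u n with (n div N) * u N, where u
  N / N is close to the infimum.\<close>

lemma fekete:
  fixes u :: "nat \<Rightarrow> real"
  assumes nonneg: "\<And>n. u n \<ge> 0" and sub: "\<And>n k. u (n + k) \<le> u n + u k"
  shows "convergent (\<lambda>n. u n / real n)"
proof -
  define L where "L = (INF n\<in>{1..}. u n / real n)"
  have bdd: "bdd_below ((\<lambda>n. u n / real n) ` {1..})"
    using nonneg by (intro bdd_belowI[of _ 0]) auto
  have mult: "u (q * n + r) \<le> real q * u n + u r" for q n r
  proof (induction q)
    case (Suc q)
    have "u (Suc q * n + r) = u (n + (q * n + r))" by (simp add: algebra_simps)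
    also have "\<dots> \<le> u n + u (q * n + r)" by (rule sub)
    finally show ?case using Suc by (simp add: algebra_simps)
  qed simp
  have "(\<lambda>n. u n / real n) \<longlonglongrightarrow> L"
  proof (rule LIMSEQ_I)
    fix e :: real assume e: "e > 0"
    have "\<exists>n\<in>{1..}. u n / real n < L + e / 2"
      using cINF_less_iff[OF _ bdd, of "L + e / 2"] e by (auto simp: L_def)
    then obtain N where N: "N \<ge> 1" and uN: "u N / real N < L + e / 2" by auto
    \<comment> \<open>Bounds the remainder term \<open>u (n mod N)\<close> for all n at
      once.\<close>
    define K where "K = (\<Sum>r<N. u r)"
    have K: "u r \<le> K" if "r < N" for r
      unfolding K_def using that nonneg by (intro member_le_sum) auto
    obtain n0 :: nat where n0: "real n0 > 2 * (K + 1) / e" using reals_Archimedean2 by blast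
    have "norm (u n / real n - L) < e" if n: "n \<ge> max n0 1" for n
    proof -
      have npos: "real n > 0" using n by simp
      have "L \<le> u n / real n" unfolding L_def using n by (intro cINF_lower[OF bdd]) auto
      moreover have "u n / real n < L + e"
      proof -
        have "u n \<le> real (n div N) * u N + u (n mod N)"
          using mult[of "n div N" N "n mod N"] by simp
        also have "\<dots> \<le> real n / real N * u N + K"
          using nonneg K[of "n mod N"] N real_of_int_div4[of "int n" "int N"]
          by (intro add_mono mult_right_mono) (auto simp flip: zdiv_int)
        finally have "u n / real n \<le> u N / real N + K / real n"
          using npos N by (simp add: field_simps)
        moreover have "K / real n < e / 2"
        proof -
          have "2 * (K + 1) / e < real n" using n0 n by linarith
          then have "2 * (K + 1) < real n * e" using e by (simp add: field_simps)
          then show ?thesis using npos by (simp add: field_simps)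
        qed
        ultimately show ?thesis using uN by linarith
      qed
      ultimately show ?thesis by simp
    qed
    then show "\<exists>no. \<forall>n\<ge>no. norm (u n / real n - L) < e" by blast
  qed
  then show ?thesis by (rule convergentI)
qed

lemma rv_entropy_measure_preserving:
  assumes X: "simple_function M X" and S: "S \<in> measurable M M" and inv: "distr M M S = M"
  shows "rv_entropy M (\<lambda>x. X (S x)) = rv_entropy M X"
proof -
  have p: "measure M {y \<in> space M. X (S y) = v} = measure M {y \<in> space M. X y = v}" for v
  proof -
    have "measure M {y \<in> space M. X y = v} = measure (distr M M S) {y \<in> space M. X y = v}"
      by (simp add: inv)
    also have "\<dots> = measure M (S -` {y \<in> space M. X y = v} \<inter> space M)"
      by (rule measure_distr[OF S simple_function_fibre_sets[OF X]])
    also have "S -` {y \<in> space M. X y = v} \<inter> space M = {y \<in> space M. X (S y) = v}"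
      using measurable_space[OF S] by auto
    finally show ?thesis ..
  qed
  have "(\<lambda>x. ln (measure M {y \<in> space M. X y = X x})) \<in> borel_measurable M"
    using borel_measurable_simple_function
      [OF simple_function_compose1[OF X, of "\<lambda>v. ln (measure M {y \<in> space M. X y = v})"]] .
  then have "(\<integral>x. ln (measure M {y \<in> space M. X y = X x}) \<partial>distr M M S)
      = (\<integral>x. ln (measure M {y \<in> space M. X y = X (S x)}) \<partial>M)"
    by (rule integral_distr[OF S])
  then show ?thesis by (simp add: rv_entropy_def p inv)
qed

section \<open>Entropy rates of measure-preserving maps\<close>

locale measure_preserving = prob_space M for M :: "'a measure" +
  fixes T :: "'a \<Rightarrow> 'a"
  assumes T[measurable]: "T \<in> measurable M M" and invariant: "distr M M T = M"
begin

text \<open>Subadditivity: an itinerary of length n + k is one of length n followed by one of length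
  k started at time n, and invariance removes the delay.\<close>

lemma entropy_wrt_partition_tendsto:
  assumes P: "finite_measurable_partition M P"
  shows "(\<lambda>n. rv_entropy M (itinerary T (part_label P) n) / real n)
    \<longlonglongrightarrow> entropy_wrt_partition M T P"
proof -
  let ?it = "itinerary T (part_label P)"
  have it: "simple_function M (?it n)" for n
    by (intro simple_function_itinerary simple_function_part_label P T)
  have "convergent (\<lambda>n. rv_entropy M (?it n) / real n)"
  proof (rule fekete)
    show "rv_entropy M (?it n) \<ge> 0" for n by (rule rv_entropy_nonneg[OF it])
    fix n k
    have it': "simple_function M (\<lambda>x. ?it k ((T ^^ n) x))"
      by (intro simple_function_compose_measurable[OF it] measurable_funpow T)
    have "rv_entropy M (?it (n + k)) \<le> rv_entropy M (\<lambda>x. (?it n x, ?it k ((T ^^ n) x)))"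
      by (rule rv_entropy_compose_le[OF simple_function_Pair[OF it it'], where f = "\<lambda>(u, v). u @ v"])
        (simp add: itinerary_add)
    also have "\<dots> \<le> rv_entropy M (?it n) + rv_entropy M (\<lambda>x. ?it k ((T ^^ n) x))"
      by (rule rv_entropy_pair_le[OF it it'])
    also have "rv_entropy M (\<lambda>x. ?it k ((T ^^ n) x)) = rv_entropy M (?it k)"
      by (intro rv_entropy_measure_preserving it measurable_funpow T distr_funpow invariant)
    finally show "rv_entropy M (?it (n + k)) \<le> rv_entropy M (?it n) + rv_entropy M (?it k)" .
  qed
  then show ?thesis
    by (simp add: entropy_wrt_partition_def convergent_LIMSEQ_iff
        partition_entropy_iterated_join[OF prob_space_axioms P T])
qed

text \<open>The itinerary of \<open>f\<close> is guessed from \<open>B\<close> one symbol at a time: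
  \<open>B\<close> determines \<open>g\<close> at time i, and \<open>r\<close> turns this into a
  conditional law for \<open>f\<close> at time i. By invariance every symbol costs the same
  integral.\<close>

lemma rv_entropy_itinerary_le:
  fixes f g :: "'a \<Rightarrow> 'b"
  assumes f: "simple_function M f" and g: "simple_function M g" and B: "simple_function M B"
    and r0: "\<And>v w. r v w > 0" and r1: "\<And>w. (\<Sum>v\<in>f ` space M. r v w) \<le> 1"
    and determined: "\<And>i. i < n \<Longrightarrow> \<exists>\<phi>. \<forall>x\<in>space M. g ((T ^^ i) x) = \<phi> (B x)"
  shows "rv_entropy M (itinerary T f n) \<le> rv_entropy M B - real n * (\<integral>x. ln (r (f x) (g x)) \<partial>M)"
proof -
  let ?c = "\<integral>x. ln (r (f x) (g x)) \<partial>M"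
  have it: "simple_function M (itinerary T f n)" for n
    by (intro simple_function_itinerary f T)
  \<comment> \<open>The induction keeps \<open>B\<close> as a second component because each further
    guess consults it; \<open>n\<close> stays fixed.\<close>
  have "rv_entropy M (\<lambda>x. (itinerary T f j x, B x)) \<le> rv_entropy M B - real j * ?c" if "j \<le> n" for j
    using that
  proof (induction j)
    case 0
    have "rv_entropy M (\<lambda>x. (itinerary T f 0 x, B x)) \<le> rv_entropy M B"
      by (rule rv_entropy_compose_le[OF B, where f = "\<lambda>b. ([], b)"]) (simp add: itinerary_def)
    then show ?case by simp
  next
    case (Suc j)
    obtain \<phi> where \<phi>: "\<And>x. x \<in> space M \<Longrightarrow> g ((T ^^ j) x) = \<phi> (B x)"
      using determined[of j] Suc.prems by auto
    have fj: "simple_function M (\<lambda>x. f ((T ^^ j) x))"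
      by (intro simple_function_compose_measurable[OF f] measurable_funpow T)
    have itB: "simple_function M (\<lambda>x. (itinerary T f j x, B x))"
      by (rule simple_function_Pair[OF it B])
    have img: "(\<lambda>x. f ((T ^^ j) x)) ` space M \<subseteq> f ` space M"
      using measurable_space[OF measurable_funpow[OF T]] by auto
    have "rv_entropy M (\<lambda>x. (itinerary T f (Suc j) x, B x))
        \<le> rv_entropy M (\<lambda>x. (f ((T ^^ j) x), (itinerary T f j x, B x)))"
      by (rule rv_entropy_compose_le[OF simple_function_Pair[OF fj itB],
            where f = "\<lambda>(v, (u, b)). (u @ [v], b)"]) (simp add: itinerary_Suc)
    also have "\<dots> \<le> rv_entropy M (\<lambda>x. (itinerary T f j x, B x))
        - (\<integral>x. ln ((\<lambda>v (u, b). r v (\<phi> b)) (f ((T ^^ j) x)) (itinerary T f j x, B x)) \<partial>M)"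
    proof (rule rv_entropy_pair_cond[OF fj itB])
      show "(\<lambda>(u, b). r v (\<phi> b)) ub \<ge> 0" "(\<lambda>(u, b). r v (\<phi> b)) ub > 0" for v ub
        using r0 by (auto simp: case_prod_beta less_imp_le)
      show "(\<Sum>v\<in>(\<lambda>x. f ((T ^^ j) x)) ` space M. (\<lambda>(u, b). r v (\<phi> b)) ub) \<le> 1" for ub
      proof -
        have "(\<Sum>v\<in>(\<lambda>x. f ((T ^^ j) x)) ` space M. (\<lambda>(u, b). r v (\<phi> b)) ub)
            \<le> (\<Sum>v\<in>f ` space M. r v (\<phi> (snd ub)))"
          using r0 simple_functionD(1)[OF f] img
          by (subst case_prod_beta, intro sum_mono2) (auto simp: less_imp_le)
        then show ?thesis using r1[of "\<phi> (snd ub)"] by simp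
      qed
    qed
    also have "(\<integral>x. ln ((\<lambda>v (u, b). r v (\<phi> b)) (f ((T ^^ j) x)) (itinerary T f j x, B x)) \<partial>M)
        = (\<integral>x. ln (r (f ((T ^^ j) x)) (g ((T ^^ j) x))) \<partial>M)"
      by (intro Bochner_Integration.integral_cong HOL.refl) (simp add: \<phi>)
    also have "\<dots> = (\<integral>x. ln (r (f x) (g x)) \<partial>distr M M (T ^^ j))"
      using borel_measurable_simple_function[OF simple_function_compose1
          [OF simple_function_Pair[OF f g], of "\<lambda>(v, w). ln (r v w)"]]
      by (intro integral_distr[symmetric] measurable_funpow T) simp
    also have "\<dots> = ?c" by (simp add: distr_funpow[OF T invariant])
    finally show ?case using Suc by (simp add: algebra_simps)
  qed
  moreover have "rv_entropy M (itinerary T f n) \<le> rv_entropy M (\<lambda>x. (itinerary T f n x, B x))"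
    by (rule rv_entropy_compose_le[OF simple_function_Pair[OF it B], where f = fst]) simp
  ultimately show ?thesis by (meson order_trans le_refl)
qed

text \<open>The guess gives mass 1 - d to agreement with \<open>g\<close> and d / N to each other
  value: agreement costs -ln (1 - d), disagreement ln (N / d).\<close>

lemma cross_entropy_disagreement:
  fixes f g :: "'a \<Rightarrow> 'b"
  assumes f: "simple_function M f" and g: "simple_function M g"
    and d: "0 < d" "d < 1" and N: "N \<ge> (1::real)"
  shows "- (\<integral>x. ln (if f x = g x then 1 - d else d / N) \<partial>M)
    \<le> - ln (1 - d) + ln (N / d) * prob {x \<in> space M. f x \<noteq> g x}"
proof -
  have fg: "simple_function M (\<lambda>x. f x \<noteq> g x)"
    using simple_function_compose1[OF simple_function_Pair[OF f g], of "\<lambda>(v, w). v \<noteq> w"] by simp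
  have E: "{x \<in> space M. f x \<noteq> g x} \<in> sets M"
    using simple_function_fibre_sets[OF fg, of True] by simp
  have "(\<integral>x. - ln (if f x = g x then 1 - d else d / N) \<partial>M)
      \<le> (\<integral>x. - ln (1 - d) + ln (N / d) * indicator {x \<in> space M. f x \<noteq> g x} x \<partial>M)"
  proof (rule integral_mono)
    show "integrable M (\<lambda>x. - ln (if f x = g x then 1 - d else d / N))"
      using integrable_simple[OF fg, of "\<lambda>b. - ln (if \<not> b then 1 - d else d / N)"] by simp
    show "integrable M (\<lambda>x. - ln (1 - d) + ln (N / d) * indicator {x \<in> space M. f x \<noteq> g x} x)"
      using E by (auto simp: emeasure_eq_measure)
    show "- ln (if f x = g x then 1 - d else d / N)
        \<le> - ln (1 - d) + ln (N / d) * indicator {x \<in> space M. f x \<noteq> g x} x" if "x \<in> space M" for x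
      using that d N by (auto simp: indicator_def ln_div ln_le_zero_iff)
  qed
  also have "\<dots> = - ln (1 - d) + ln (N / d) * prob {x \<in> space M. f x \<noteq> g x}"
    using E prob_space
    by (subst Bochner_Integration.integral_add) (auto simp: emeasure_eq_measure Int_def conj_commute)
  finally show ?thesis by simp
qed

text \<open>\<open>B k n\<close> stands for an observation of length n with a margin k on both
  sides. By \<open>approx\<close> a suitable margin predicts any partition up to a small error, and
  by \<open>lim\<close> no margin alters the rate. The lower bound comes from \<open>Q\<close>,
  whose itineraries have at least the entropy of the observation with margin 0.\<close>

theorem ks_entropy_generator:
  fixes B :: "nat \<Rightarrow> nat \<Rightarrow> 'a \<Rightarrow> 'b"
  assumes B: "\<And>k n. simple_function M (B k n)"
    and lim: "\<And>k. (\<lambda>n. rv_entropy M (B k n) / real n) \<longlonglongrightarrow> h"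
    and approx: "\<And>P e. finite_measurable_partition M P \<Longrightarrow> e > 0 \<Longrightarrow>
      \<exists>k g. simple_function M g \<and> (\<forall>n. \<forall>i<n. \<exists>\<phi>. \<forall>x\<in>space M. g ((T ^^ i) x) = \<phi> (B k n x))
        \<and> prob {x \<in> space M. part_label P x \<noteq> g x} < e"
    and generator: "finite_measurable_partition M Q"
      "\<And>n. rv_entropy M (B 0 n) \<le> rv_entropy M (itinerary T (part_label Q) n)"
  shows "ks_entropy M T = ereal h"
proof (rule antisym)
  show "ks_entropy M T \<le> ereal h"
    unfolding ks_entropy_def
  proof (rule SUP_least, clarsimp)
    fix P assume P: "finite_measurable_partition M P"
    let ?f = "part_label P"
    have f: "simple_function M ?f" by (rule simple_function_part_label[OF P])
    have part: "partition_on (space M) P" and fin: "finite P"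
      using P by (auto simp: finite_measurable_partition_def)
    have "P \<noteq> {}" using partition_onD1[OF part] not_empty by auto
    then have N: "real (card P) \<ge> 1" using fin by (simp add: Suc_leI card_gt_0_iff)
    show "entropy_wrt_partition M T P \<le> h"
    proof (rule field_le_epsilon)
      fix e :: real assume e: "e > 0"
      \<comment> \<open>Makes the cost -ln (1 - d) of agreement equal to e / 2. The tolerance of the
        approximation is fixed afterwards, since it has to beat ln (card P / d).\<close>
      define d where "d = 1 - exp (- (e / 2))"
      have d: "0 < d" "d < 1" and lnd: "- ln (1 - d) = e / 2" using e by (auto simp: d_def)
      have lnN: "ln (real (card P) / d) > 0" using N d by (simp add: field_simps)
      obtain k g where g: "simple_function M g"
        and det: "\<And>n i. i < n \<Longrightarrow> \<exists>\<phi>. \<forall>x\<in>space M. g ((T ^^ i) x) = \<phi> (B k n x)"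
        and close: "prob {x \<in> space M. ?f x \<noteq> g x} < e / 2 / ln (real (card P) / d)"
        using approx[OF P, of "e / 2 / ln (real (card P) / d)"] e lnN by (auto simp: divide_pos_pos)
      let ?r = "\<lambda>v w. if v = w then 1 - d else d / real (card P)"
      let ?c = "- (\<integral>x. ln (?r (?f x) (g x)) \<partial>M)"
      have "?c \<le> e / 2 + ln (real (card P) / d) * prob {x \<in> space M. ?f x \<noteq> g x}"
        using cross_entropy_disagreement[OF f g d N] lnd by simp
      also have "\<dots> \<le> e" using close lnN by (simp add: field_simps)
      finally have c: "?c \<le> e" .
      have r1: "(\<Sum>v\<in>?f ` space M. ?r v w) \<le> 1" for w
      proof -
        have "(\<Sum>v\<in>?f ` space M. ?r v w) \<le> (\<Sum>v\<in>P. ?r v w)"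
          using part_label[OF part] fin d by (intro sum_mono2) auto
        \<comment> \<open>Adding d / card P also at v = w only overestimates, and the total is still
          at most (1 - d) + d.\<close>
        also have "\<dots> \<le> (\<Sum>v\<in>P. (if v = w then 1 - d else 0) + d / real (card P))"
          using d by (intro sum_mono) auto
        also have "\<dots> \<le> (1 - d) + d"
          using fin d N by (auto simp: sum.distrib)
        finally show ?thesis by simp
      qed
      have "rv_entropy M (itinerary T ?f n) / real n \<le> rv_entropy M (B k n) / real n + e" if "n \<ge> 1" for n
      proof -
        have "rv_entropy M (itinerary T ?f n) \<le> rv_entropy M (B k n) + real n * ?c"
          using rv_entropy_itinerary_le[OF f g B, of ?r n k n] r1 d N det[of _ n]
          by (simp add: divide_pos_pos)
        also have "\<dots> \<le> rv_entropy M (B k n) + real n * e"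
          using c by (intro add_left_mono mult_left_mono) auto
        finally show ?thesis using that by (simp add: field_simps)
      qed
      then show "entropy_wrt_partition M T P \<le> h + e"
        by (intro LIMSEQ_le[OF entropy_wrt_partition_tendsto[OF P] tendsto_add[OF lim tendsto_const]]) blast
    qed
  qed
next
  have "h \<le> entropy_wrt_partition M T Q"
    using generator(2)
    by (intro LIMSEQ_le[OF lim[of 0] entropy_wrt_partition_tendsto[OF generator(1)]] exI[of _ 0])
      (auto intro: divide_right_mono)
  then show "ereal h \<le> ks_entropy M T"
    unfolding ks_entropy_def using generator(1) by (intro SUP_upper2[of Q]) auto
qed

end

section \<open>Uniform product measures and recurrence of the simple random walk\<close>

lemma uniform_PiM_cylinder_distinct:
  fixes A :: "'a set" and I :: "'i set"
  assumes A: "finite A" "A \<noteq> {}" and J: "finite J" "J \<subseteq> I" and c: "\<And>j. j \<in> J \<Longrightarrow> c j \<in> A"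
  defines "U \<equiv> PiM I (\<lambda>_. uniform_count_measure A)"
  shows "emeasure U {x \<in> space U. \<forall>j\<in>J. x j = c j} = ennreal ((1 / real (card A)) ^ card J)"
proof -
  interpret product_prob_space "\<lambda>_. uniform_count_measure A" I
    by (intro product_prob_spaceI prob_space_uniform_count_measure A)
  have "emeasure U {x \<in> space U. \<forall>j\<in>J. x j \<in> {c j}}
      = (\<Prod>j\<in>J. emeasure (uniform_count_measure A) {c j})"
    unfolding U_def using J c by (intro emeasure_PiM_Collect) (auto simp: sets_uniform_count_measure)
  also have "\<dots> = (\<Prod>j\<in>J. ennreal (1 / real (card A)))"
    using A c by (intro prod.cong) (auto simp: emeasure_uniform_count_measure)
  also have "\<dots> = ennreal ((1 / real (card A)) ^ card J)"
    by (simp add: ennreal_power)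
  finally show ?thesis by simp
qed

lemma space_uniform_PiM: "space (PiM UNIV (\<lambda>_. uniform_count_measure A)) = {x. \<forall>i. x i \<in> A}"
  by (auto simp: space_PiM space_uniform_count_measure PiE_def)

lemma prob_space_uniform_PiM:
  "finite A \<Longrightarrow> A \<noteq> {} \<Longrightarrow> prob_space (PiM I (\<lambda>_. uniform_count_measure A))"
  by (intro prob_space_PiM prob_space_uniform_count_measure)

lemma uniform_PiM_component_measurable:
  assumes "i \<in> I"
  shows "(\<lambda>x. x i) \<in> measurable (PiM I (\<lambda>_. uniform_count_measure A)) (count_space UNIV)"
proof -
  have "(\<lambda>x. x i) \<in> measurable (PiM I (\<lambda>_. uniform_count_measure A)) (uniform_count_measure A)"
    by (rule measurable_component_singleton[OF assms])
  also have "measurable (PiM I (\<lambda>_. uniform_count_measure A)) (uniform_count_measure A)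
      = measurable (PiM I (\<lambda>_. uniform_count_measure A)) (count_space A)"
    by (intro measurable_cong_sets HOL.refl sets_uniform_count_measure_count_space)
  finally show ?thesis by (rule measurable_compose[where g = "\<lambda>x. x"]) simp
qed

lemma Collect_count_space_sets:
  "f \<in> measurable M (count_space UNIV) \<Longrightarrow> {x \<in> space M. P (f x)} \<in> sets M"
  using measurable_sets[of f M "count_space UNIV" "{v. P v}"] by (simp add: vimage_def Int_def conj_commute)

text \<open>The constraints may repeat an index \<open>\<sigma> t\<close>; they then either agree or are contradictory.\<close>
lemma uniform_PiM_cylinder:
  fixes A :: "'a set" and \<sigma> :: "nat \<Rightarrow> int"
  assumes A: "finite A" "A \<noteq> {}" and c: "\<And>t. t < n \<Longrightarrow> c t \<in> A"
  defines "U \<equiv> PiM UNIV (\<lambda>_::int. uniform_count_measure A)"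
  shows "emeasure U {x \<in> space U. \<forall>t<n. x (\<sigma> t) = c t}
    = (if \<forall>t<n. \<forall>t'<n. \<sigma> t = \<sigma> t' \<longrightarrow> c t = c t'
       then ennreal ((1 / real (card A)) ^ card (\<sigma> ` {..<n})) else 0)"
proof (cases "\<forall>t<n. \<forall>t'<n. \<sigma> t = \<sigma> t' \<longrightarrow> c t = c t'")
  case True
  \<comment> \<open>Moves the constraints from the times t to the indices; the choice is immaterial
    because times with the same index agree.\<close>
  define d where "d j = c (SOME t. t < n \<and> \<sigma> t = j)" for j
  have d: "d (\<sigma> t) = c t" if "t < n" for t
  proof -
    let ?s = "SOME t'. t' < n \<and> \<sigma> t' = \<sigma> t"
    have "?s < n \<and> \<sigma> ?s = \<sigma> t"
      by (rule someI[of _ t]) (use that in simp)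
    then show ?thesis using True[rule_format, of ?s t] that unfolding d_def by blast
  qed
  have "{x \<in> space U. \<forall>t<n. x (\<sigma> t) = c t} = {x \<in> space U. \<forall>j\<in>\<sigma> ` {..<n}. x j = d j}"
    using d by auto
  moreover have "d j \<in> A" if "j \<in> \<sigma> ` {..<n}" for j using that d c by auto
  ultimately show ?thesis
    unfolding if_P[OF True]
    using uniform_PiM_cylinder_distinct[OF A finite_imageI[OF finite_lessThan] subset_UNIV, of \<sigma> n d]
    by (simp add: U_def)
next
  case False
  then obtain t t' where t: "t < n" "t' < n" "\<sigma> t = \<sigma> t'" "c t \<noteq> c t'" by blast
  have "\<not> (\<forall>t<n. x (\<sigma> t) = c t)" for x
  proof
    assume "\<forall>t<n. x (\<sigma> t) = c t"
    then have "x (\<sigma> t) = c t" "x (\<sigma> t') = c t'" using t(1,2) by blast+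
    with t(3,4) show False by simp
  qed
  then have "{x \<in> space U. \<forall>t<n. x (\<sigma> t) = c t} = {}" by blast
  then show ?thesis unfolding if_not_P[OF False] by (simp only: emeasure_empty)
qed

section \<open>Bit patterns under the fair coin measure\<close>

lemma prob_space_mu1: "prob_space mu1"
  unfolding mu1_def by (rule prob_space_uniform_PiM) auto

lemma space_mu1: "space mu1 = {z. \<forall>n. z n \<in> {0, 1}}"
  by (simp add: mu1_def space_uniform_PiM)

lemma mu1_component: "(\<lambda>z. z i) \<in> measurable mu1 (count_space UNIV)"
  unfolding mu1_def by (rule uniform_PiM_component_measurable) simp

lemma simple_function_mu1_bits: "simple_function mu1 (\<lambda>z. map (\<lambda>t. z (\<sigma> t) = v) [0..<n])"
proof -
  have "{z \<in> space mu1. map (\<lambda>t. z (\<sigma> t) = v) [0..<n] = bs} \<in> sets mu1" for bs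
  proof -
    have "{z \<in> space mu1. map (\<lambda>t. z (\<sigma> t) = v) [0..<n] = bs}
        = {z \<in> space mu1. length bs = n \<and> (\<forall>t\<in>{..<n}. (z (\<sigma> t) = v) = bs ! t)}"
      by (auto simp: list_eq_iff_nth_eq)
    also have "\<dots> \<in> sets mu1"
    proof (rule sets.sets_Collect_conj)
      show "{z \<in> space mu1. \<forall>t\<in>{..<n}. (z (\<sigma> t) = v) = bs ! t} \<in> sets mu1"
        by (rule sets.sets_Collect_finite_All)
          (rule Collect_count_space_sets[OF mu1_component, where P = "\<lambda>x. (x = v) = bs ! _"], simp)
    qed simp
    finally show ?thesis .
  qed
  moreover have "finite ((\<lambda>z. map (\<lambda>t. z (\<sigma> t) = v) [0..<n]) ` space mu1)"
    by (rule finite_subset[OF _ finite_lists_length_eq[of UNIV n]]) auto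
  ultimately show ?thesis
    unfolding simple_function_def by (simp add: vimage_def Int_def conj_commute)
qed

lemma mu1_bits_prob:
  assumes \<sigma>: "inj \<sigma>" and v: "v \<in> {0, 1}" and bs: "length bs = n"
  shows "measure mu1 {z \<in> space mu1. map (\<lambda>t. z (\<sigma> t) = v) [0..<n] = bs} = 1 / 2 ^ n"
proof -
  let ?c = "\<lambda>t. if bs ! t then v else 1 - v"
  have "{z \<in> space mu1. map (\<lambda>t. z (\<sigma> t) = v) [0..<n] = bs} = {z \<in> space mu1. \<forall>t<n. z (\<sigma> t) = ?c t}"
    (is "?L = ?R")
  proof (intro Collect_cong conj_cong HOL.refl)
    fix z assume z: "z \<in> space mu1"
    have "(z (\<sigma> t) = v) = bs ! t \<longleftrightarrow> z (\<sigma> t) = ?c t" for t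
    proof -
      have "z (\<sigma> t) = 0 \<or> z (\<sigma> t) = 1" using z by (simp add: space_mu1)
      then show ?thesis using v by (elim disjE insertE) auto
    qed
    then show "(map (\<lambda>t. z (\<sigma> t) = v) [0..<n] = bs) = (\<forall>t<n. z (\<sigma> t) = ?c t)"
      using bs by (auto simp: list_eq_iff_nth_eq)
  qed
  moreover have "emeasure mu1 ?R = (if \<forall>t<n. \<forall>t'<n. \<sigma> t = \<sigma> t' \<longrightarrow> ?c t = ?c t'
       then ennreal ((1 / real (card {0, 1 :: int})) ^ card (\<sigma> ` {..<n})) else 0)"
    unfolding mu1_def by (rule uniform_PiM_cylinder) (use v in auto)
  then have "emeasure mu1 ?R = ennreal ((1 / 2) ^ n)"
    by (simp only: inj_eq[OF \<sigma>] card_image[OF inj_on_subset[OF \<sigma> subset_UNIV]]) simp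
  ultimately show ?thesis by (simp add: measure_def power_one_over)
qed

section \<open>First passage of the fair random walk\<close>

fun stays_positive :: "nat \<Rightarrow> bool list \<Rightarrow> bool" where
  "stays_positive k [] = (k > 0)"
| "stays_positive k (b # bs) = (k > 0 \<and> stays_positive (if b then k + 1 else k - 1) bs)"

text \<open>First-step analysis of the gambler's ruin: the probability that a fair walk from k stays
  positive through time n, with 0 absorbing.\<close>

fun survival :: "nat \<Rightarrow> nat \<Rightarrow> real" where
  "survival 0 k = of_bool (k > 0)"
| "survival (Suc n) 0 = 0"
| "survival (Suc n) (Suc k) = (survival n (k + 2) + survival n k) / 2"

lemma card_lists_Suc:
  "card {bs. length bs = Suc n \<and> P bs}
    = card {bs. length bs = n \<and> P (True # bs)} + card {bs. length bs = n \<and> P (False # bs)}"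
proof -
  have fin: "finite {bs :: bool list. length bs = n \<and> Q bs}" for Q
    by (rule finite_subset[OF _ finite_lists_length_eq[of UNIV n]]) auto
  have "{bs. length bs = Suc n \<and> P bs}
      = (#) True ` {bs. length bs = n \<and> P (True # bs)} \<union> (#) False ` {bs. length bs = n \<and> P (False # bs)}"
    (is "?L = ?R")
  proof (rule set_eqI)
    show "bs \<in> ?L \<longleftrightarrow> bs \<in> ?R" for bs by (cases bs; cases "hd bs") auto
  qed
  also have "card \<dots> = card ((#) True ` {bs. length bs = n \<and> P (True # bs)})
      + card ((#) False ` {bs. length bs = n \<and> P (False # bs)})"
    by (intro card_Un_disjoint finite_imageI fin) auto
  finally show ?thesis by (simp add: card_image)
qed

lemma card_stays_positive:
  "real (card {bs. length bs = n \<and> stays_positive k bs}) = survival n k * 2 ^ n"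
proof (induction n k rule: survival.induct)
  case (1 k)
  have "{bs :: bool list. length bs = 0 \<and> stays_positive k bs} = (if k > 0 then {[]} else {})" by auto
  then show ?case by simp
next
  case (2 n)
  have "{bs :: bool list. length bs = Suc n \<and> stays_positive 0 bs} = {}" by (auto simp: length_Suc_conv)
  then show ?case by (simp only: card.empty survival.simps)
next
  case (3 n k)
  then show ?case
    by (subst card_lists_Suc) (simp add: field_simps)
qed

lemma survival_bounds: "0 \<le> survival n k \<and> survival n k \<le> 1"
  by (induction n k rule: survival.induct) auto

lemma survival_Suc_le: "survival (Suc n) k \<le> survival n k"
proof (induction n arbitrary: k)
  case 0
  show ?case by (cases k) auto
next
  case (Suc n)
  show ?case
  proof (cases k)
    case (Suc j)
    show ?thesis
      unfolding Suc survival.simps(3)[of "Suc n" j] survival.simps(3)[of n j]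
      by (intro divide_right_mono add_mono Suc.IH) simp
  qed simp
qed

text \<open>The limit is a bounded harmonic function of the starting point that vanishes at \<open>0\<close>, hence
  linear and bounded, hence zero.\<close>
lemma survival_tendsto_0: "(\<lambda>n. survival n k) \<longlonglongrightarrow> 0"
proof -
  define g where "g k = lim (\<lambda>n. survival n k)" for k
  have lim: "(\<lambda>n. survival n k) \<longlonglongrightarrow> g k" for k
  proof -
    have "decseq (\<lambda>n. survival n k)" by (intro decseq_SucI survival_Suc_le)
    then obtain L where "(\<lambda>n. survival n k) \<longlonglongrightarrow> L"
      using survival_bounds by (blast intro: decseq_convergent[of _ 0])
    then show ?thesis by (simp add: g_def limI)
  qed
  have g0: "g 0 = 0"
  proof -
    have "(\<lambda>n. survival (Suc n) 0) \<longlonglongrightarrow> g 0" using lim by (rule LIMSEQ_Suc)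
    then show ?thesis by (simp add: LIMSEQ_const_iff)
  qed
  have harmonic: "g (Suc k) = (g (k + 2) + g k) / 2" for k
  proof -
    have "(\<lambda>n. survival (Suc n) (Suc k)) \<longlonglongrightarrow> (g (k + 2) + g k) / 2"
      unfolding survival.simps by (intro tendsto_intros lim) simp
    then show ?thesis using LIMSEQ_unique LIMSEQ_Suc[OF lim] by blast
  qed
  \<comment> \<open>A pair of consecutive values is what the second-order recurrence propagates;
    \<open>g0\<close> leaves \<open>g 1\<close> as the only free parameter.\<close>
  have linear: "g k = real k * g 1 \<and> g (Suc k) = real (Suc k) * g 1" for k
  proof (induction k)
    case (Suc k)
    then show ?case using harmonic[of k] by (auto simp: algebra_simps)
  qed (simp add: g0)
  have g_bounds: "0 \<le> g k" "g k \<le> 1" for k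
    using survival_bounds by (auto intro: LIMSEQ_le_const[OF lim] LIMSEQ_le_const2[OF lim])
  have "g 1 = 0"
  proof (rule ccontr)
    assume "g 1 \<noteq> 0"
    then have "g 1 > 0" using g_bounds[of 1] by simp
    then obtain k :: nat where "real k * g 1 > 1" using reals_Archimedean3[of "g 1"] by blast
    then show False using linear[of k] g_bounds(2)[of k] by linarith
  qed
  then show ?thesis using lim[of k] linear[of k] by simp
qed

lemma stays_positive_map:
  "stays_positive k (map Y [0..<n])
    \<longleftrightarrow> (\<forall>j\<le>n. int k + (\<Sum>t<j. if Y t then 1 else - 1) > 0)"
proof (induction n arbitrary: k Y)
  case (Suc n)
  have map: "map Y [0..<Suc n] = Y 0 # map (\<lambda>t. Y (Suc t)) [0..<n]"
    by (simp add: upt_conv_Cons map_Suc_upt[symmetric] del: upt_Suc)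
  have split: "(\<forall>j\<le>Suc n. Q j) \<longleftrightarrow> Q 0 \<and> (\<forall>j\<le>n. Q (Suc j))" for Q
  proof safe
    fix j assume "Q 0" "\<forall>j\<le>n. Q (Suc j)" "j \<le> Suc n"
    then show "Q j" by (cases j) auto
  qed auto
  show ?case
    unfolding map stays_positive.simps Suc.IH split sum.lessThan_Suc_shift
    by (cases "k > 0"; cases "Y 0") (simp_all add: of_nat_diff algebra_simps)
qed simp

text \<open>The enumeration \<open>\<sigma>\<close> and the up-bit \<open>v\<close> let one
  statement serve both ends: going right a 1 raises the height, going left a 0 does. A walk that
  never descends to -k survives forever when started at k, and the survival probabilities tend to
  0.\<close>

lemma walk_unbounded_below:
  fixes \<sigma> :: "nat \<Rightarrow> int"
  assumes \<sigma>: "inj \<sigma>" and v: "v \<in> {0, 1}"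
  shows "AE z in mu1. \<forall>k::nat. \<exists>j. (\<Sum>t<j. if z (\<sigma> t) = v then 1 else - 1) \<le> - int k"
  unfolding AE_all_countable
proof
  fix k :: nat
  interpret prob_space mu1 by (rule prob_space_mu1)
  define E where "E n = {z \<in> space mu1. stays_positive k (map (\<lambda>t. z (\<sigma> t) = v) [0..<n])}" for n
  have E_eq: "E n = (\<Union>bs\<in>{bs. length bs = n \<and> stays_positive k bs}.
      {z \<in> space mu1. map (\<lambda>t. z (\<sigma> t) = v) [0..<n] = bs})" for n
    by (auto simp: E_def)
  have meas: "{z \<in> space mu1. map (\<lambda>t. z (\<sigma> t) = v) [0..<n] = bs} \<in> sets mu1" for n bs
    using simple_functionD(2)[OF simple_function_mu1_bits[of \<sigma> v n], of "{bs}"]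
    by (simp add: vimage_def Int_def conj_commute)
  have fin: "finite {bs :: bool list. length bs = n \<and> Q bs}" for n Q
    by (rule finite_subset[OF _ finite_lists_length_eq[of UNIV n]]) auto
  have E_sets: "E n \<in> sets mu1" for n unfolding E_eq using meas fin by (intro sets.finite_UN) auto
  have "prob (E n) = survival n k" for n
  proof -
    have "prob (E n) = (\<Sum>bs\<in>{bs. length bs = n \<and> stays_positive k bs}.
        prob {z \<in> space mu1. map (\<lambda>t. z (\<sigma> t) = v) [0..<n] = bs})"
      unfolding E_eq using meas fin
      by (intro measure_finite_Union) (auto simp: disjoint_family_on_def emeasure_eq_measure)
    also have "\<dots> = survival n k"
      using card_stays_positive[of n k] by (simp add: mu1_bits_prob[OF \<sigma> v])
    finally show ?thesis .
  qed
  then have lim: "(\<lambda>n. prob (E n)) \<longlonglongrightarrow> 0" using survival_tendsto_0 by simp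
  have sets: "(\<Inter>n. E n) \<in> sets mu1" using E_sets by auto
  have "prob (\<Inter>n. E n) \<le> 0"
    by (rule LIMSEQ_le_const[OF lim]) (auto intro!: exI[of _ 0] finite_measure_mono E_sets)
  then have "prob (\<Inter>n. E n) = 0" using measure_nonneg[of mu1 "\<Inter>n. E n"] by linarith
  then have "(\<Inter>n. E n) \<in> null_sets mu1"
    using sets by (intro null_setsI) (simp_all add: emeasure_eq_measure)
  then show "AE z in mu1. \<exists>j. (\<Sum>t<j. if z (\<sigma> t) = v then 1 else - 1) \<le> - int k"
  proof (rule AE_I', intro subsetI INT_I)
    fix z n assume "z \<in> {z \<in> space mu1. \<not> (\<exists>j. (\<Sum>t<j. if z (\<sigma> t) = v then 1 else - 1) \<le> - int k)}"
    then have z: "z \<in> space mu1" and "\<not> (\<Sum>t<j. if z (\<sigma> t) = v then 1 else - 1) \<le> - int k" for j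
      by blast+
    then have "0 < int k + (\<Sum>t<j. if z (\<sigma> t) = v then 1 else - 1)" for j
      by (metis add.inverse_inverse add.commute diff_gt_0_iff_gt diff_minus_eq_add not_le)
    with z show "z \<in> E n" by (simp add: E_def stays_positive_map)
  qed
qed

section \<open>Heights and full measure of the recurrent sequences\<close>

lemma height_0: "height z 0 = 0"
  by (simp add: height_def)

lemma height_Suc: "height z (i + 1) = height z i + (of_bool (z i = 1) - of_bool (z i = 0))"
proof -
  consider "i \<ge> 0" | "i = - 1" | "i < - 1" by linarith
  then show ?thesis
  proof cases
    case 1
    then have "{0..i} = insert i {0..i - 1}" by auto
    with 1 show ?thesis by (simp add: height_def)
  next
    case 2
    then show ?thesis by (simp add: height_def)
  next
    case 3
    then have "{i..-1} = insert i {i + 1..-1}" by auto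
    with 3 show ?thesis by (simp add: height_def)
  qed
qed

lemma height_int:
  assumes "\<And>n. z n \<in> {0, 1}"
  shows "height z (int j) = (\<Sum>t<j. if z (int t) = 1 then 1 else - 1)"
proof (induction j)
  case (Suc j)
  have "height z (int (Suc j)) = height z (int j + 1)" by (simp add: add.commute)
  with Suc assms[of "int j"] show ?case unfolding height_Suc by auto
qed (simp add: height_0)

lemma height_minus_int:
  assumes "\<And>n. z n \<in> {0, 1}"
  shows "height z (- int j) = (\<Sum>t<j. if z (- 1 - int t) = 0 then 1 else - 1)"
proof (induction j)
  case (Suc j)
  have "height z (- int j) = height z (- 1 - int j + 1)" by simp
  with Suc assms[of "- 1 - int j"] show ?case unfolding height_Suc by auto
qed (simp add: height_0)

lemma abs_height_le: "\<bar>height z i\<bar> \<le> \<bar>i\<bar>"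
proof (induction i rule: int_induct[of _ 0])
  case (step1 i)
  then show ?case by (auto simp: height_Suc split: if_splits)
next
  case (step2 i)
  then show ?case using height_Suc[of z "i - 1"] by (auto simp: of_bool_def split: if_splits)
qed (simp add: height_0)

text \<open>By \<open>abs_height_le\<close> a very low height occurs only far out. So a height
  unbounded below on a half-line is unbounded below near its infinite end, which is the condition on
  the lower limit.\<close>

lemma Liminf_height_eq_MInf:
  assumes F: "F = at_top \<and> D = {0..} \<or> F = at_bot \<and> D = {..0::int}"
  shows "Liminf F (\<lambda>n. ereal (of_int (height z n))) = - \<infinity> \<longleftrightarrow> (\<forall>k::nat. \<exists>n\<in>D. height z n \<le> - int k)"
proof safe
  fix k :: nat
  assume lim: "Liminf F (\<lambda>n. ereal (of_int (height z n))) = - \<infinity>"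
  show "\<exists>n\<in>D. height z n \<le> - int k"
  proof (rule ccontr)
    assume "\<not> (\<exists>n\<in>D. height z n \<le> - int k)"
    then have "- int k \<le> height z n" if "n \<in> D" for n using that by force
    then have *: "ereal (of_int (- int k)) \<le> ereal (of_int (height z n))" if "n \<in> D" for n
      using that by (simp only: ereal_less_eq of_int_le_iff)
    have "eventually (\<lambda>n. n \<in> D) F"
      using F by (auto intro: eventually_ge_at_top eventually_le_at_bot)
    then have "ereal (of_int (- int k)) \<le> Liminf F (\<lambda>n. ereal (of_int (height z n)))"
      by (intro Liminf_bounded) (rule eventually_mono, assumption, rule *)
    then show False using lim by simp
  qed
next
  assume unb: "\<forall>k::nat. \<exists>n\<in>D. height z n \<le> - int k"
  show "Liminf F (\<lambda>n. ereal (of_int (height z n))) = - \<infinity>"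
  proof (rule ereal_bot, rule ccontr)
    fix B assume "\<not> Liminf F (\<lambda>n. ereal (of_int (height z n))) \<le> ereal B"
    then have "eventually (\<lambda>n. ereal B < ereal (of_int (height z n))) F"
      by (intro less_LiminfD) simp
    then have "\<exists>N. \<forall>n\<in>D. \<bar>n\<bar> \<ge> N \<longrightarrow> B < real_of_int (height z n)"
      using F
    proof (elim disjE conjE)
      assume "eventually (\<lambda>n. ereal B < ereal (of_int (height z n))) F" "F = at_top" "D = {0..}"
      then obtain N where "\<And>n. n \<ge> N \<Longrightarrow> B < real_of_int (height z n)"
        by (auto simp: eventually_at_top_linorder)
      then show ?thesis using \<open>D = {0..}\<close> by (intro exI[of _ N]) auto
    next
      assume "eventually (\<lambda>n. ereal B < ereal (of_int (height z n))) F" "F = at_bot" "D = {..0}"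
      then obtain N where "\<And>n. n \<le> N \<Longrightarrow> B < real_of_int (height z n)"
        by (auto simp: eventually_at_bot_linorder)
      then show ?thesis using \<open>D = {..0}\<close> by (intro exI[of _ "- N"]) auto
    qed
    then obtain N where N: "\<And>n. n \<in> D \<Longrightarrow> \<bar>n\<bar> \<ge> N \<Longrightarrow> B < real_of_int (height z n)" by blast
    \<comment> \<open>The first summand pushes the low position beyond \<open>N\<close>, the second
      pushes its height below \<open>B\<close>.\<close>
    define k where "k = nat \<bar>N\<bar> + nat \<lceil>\<bar>B\<bar>\<rceil>"
    obtain n where n: "n \<in> D" "height z n \<le> - int k" using unb by blast
    have "int k \<ge> \<bar>N\<bar>" by (simp add: k_def)
    then have "\<bar>n\<bar> \<ge> N" using abs_height_le[of z n] n(2) by linarith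
    then have "B < real_of_int (height z n)" using N n by simp
    moreover have "real_of_int (height z n) \<le> B"
    proof -
      have "- 1 < \<bar>B\<bar>" by (rule order.strict_trans2[OF _ abs_ge_zero]) simp
      then have "int k \<ge> \<lceil>\<bar>B\<bar>\<rceil>" by (simp add: k_def)
      then have "height z n \<le> - \<lceil>\<bar>B\<bar>\<rceil>" using n(2) by linarith
      then show ?thesis by linarith
    qed
    ultimately show False by simp
  qed
qed

lemma S_inf_eq:
  "S_inf = {z \<in> space mu1. (\<forall>k::nat. \<exists>n\<in>{0..}. height z n \<le> - int k)
     \<and> (\<forall>k::nat. \<exists>n\<in>{..0}. height z n \<le> - int k)}"
  unfolding S_inf_def space_mu1
  using Liminf_height_eq_MInf[of at_top "{0..}"] Liminf_height_eq_MInf[of at_bot "{..0}"]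
  by simp

lemma measurable_count_space_binop:
  assumes f: "f \<in> measurable M (count_space (UNIV :: 'a :: countable set))"
    and g: "g \<in> measurable M (count_space UNIV)"
  shows "(\<lambda>x. h (f x) (g x)) \<in> measurable M (count_space UNIV)"
  by (rule measurable_compose_countable[OF _ f]) (rule measurable_compose[OF g], simp)

lemma height_measurable: "(\<lambda>z. height z i) \<in> measurable mu1 (count_space UNIV)"
proof (induction i rule: int_induct[of _ 0])
  case base
  then show ?case by (simp add: height_0)
next
  case (step1 i)
  show ?case unfolding height_Suc
    using measurable_count_space_binop[OF step1(2) mu1_component[of i],
        of "\<lambda>h v. h + (of_bool (v = 1) - of_bool (v = 0))"] by simp
next
  case (step2 i)
  have "height z (i - 1) = height z i - (of_bool (z (i - 1) = 1) - of_bool (z (i - 1) = 0))" for z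
    using height_Suc[of z "i - 1"] by simp
  then show ?case
    using measurable_count_space_binop[OF step2(2) mu1_component[of "i - 1"],
        of "\<lambda>h v. h - (of_bool (v = 1) - of_bool (v = 0))"] by simp
qed

lemma S_inf_sets: "S_inf \<in> sets mu1"
proof -
  let ?A = "\<lambda>n k. {z \<in> space mu1. height z n \<le> - int k}"
  have "?A n k \<in> sets mu1" for n k
    by (rule Collect_count_space_sets[OF height_measurable])
  then have "(\<Inter>k. \<Union>n\<in>{0..}. ?A n k) \<inter> (\<Inter>k. \<Union>n\<in>{..0}. ?A n k) \<in> sets mu1"
    by (intro sets.Int sets.countable_INT sets.countable_UN' image_subsetI) auto
  moreover have "S_inf = (\<Inter>k. \<Union>n\<in>{0..}. ?A n k) \<inter> (\<Inter>k. \<Union>n\<in>{..0}. ?A n k)"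
    unfolding S_inf_eq by blast
  ultimately show ?thesis by simp
qed

lemma AE_S_inf: "AE z in mu1. z \<in> S_inf"
proof -
  have 1: "AE z in mu1. \<forall>k::nat. \<exists>j. (\<Sum>t<j. if z (int t) = 1 then 1 else - 1) \<le> - int k"
    by (rule walk_unbounded_below) (auto simp: inj_def)
  have 2: "AE z in mu1. \<forall>k::nat. \<exists>j. (\<Sum>t<j. if z (- 1 - int t) = 0 then 1 else - 1) \<le> - int k"
    by (rule walk_unbounded_below) (auto simp: inj_def)
  from 1 2 AE_space show ?thesis
  proof eventually_elim
    case (elim z)
    have z: "z n \<in> {0, 1}" for n using elim(3) by (simp add: space_mu1)
    have "\<exists>n\<in>{0..}. height z n \<le> - int k" for k
    proof -
      obtain j where "height z (int j) \<le> - int k" using elim(1) unfolding height_int[OF z] by blast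
      then show ?thesis by (intro bexI[of _ "int j"]) auto
    qed
    moreover have "\<exists>n\<in>{..0}. height z n \<le> - int k" for k
    proof -
      obtain j where "height z (- int j) \<le> - int k"
        using elim(2) unfolding height_minus_int[OF z] by blast
      then show ?thesis by (intro bexI[of _ "- int j"]) auto
    qed
    ultimately show ?case using elim(3) by (simp add: S_inf_eq)
  qed
qed

section \<open>The coding map takes values in the Dyck shift\<close>

text \<open>The Dyck monoid acts by partial maps on infinite stacks: \<open>\<alpha>\<^sub>j\<close> pushes \<open>j\<close>, and \<open>\<beta>\<^sub>j\<close> pops \<open>j\<close>
  if it is on top. A word that is congruent to zero acts as the nowhere defined map.\<close>
fun stack_act :: "letter list \<Rightarrow> (nat \<Rightarrow> nat) \<Rightarrow> (nat \<Rightarrow> nat) option" where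
  "stack_act [] s = Some s"
| "stack_act (Alpha j # w) s = stack_act w (case_nat j s)"
| "stack_act (Beta j # w) s = (if s 0 = j then stack_act w (\<lambda>k. s (Suc k)) else None)"

definition stack_act0 :: "letter list option \<Rightarrow> (nat \<Rightarrow> nat) \<Rightarrow> (nat \<Rightarrow> nat) option" where
  "stack_act0 u s = Option.bind u (\<lambda>w. stack_act w s)"

lemma stack_act_append: "stack_act (u @ v) s = Option.bind (stack_act u s) (stack_act v)"
  by (induction u s rule: stack_act.induct) auto

lemma stack_act0_mult: "stack_act0 (mult0 u v) s = Option.bind (stack_act0 u s) (stack_act0 v)"
  by (cases u; cases v) (auto simp: stack_act0_def stack_act_append split: bind_split)

lemma dyck_cong_stack_act: "dyck_cong m u v \<Longrightarrow> stack_act0 u s = stack_act0 v s"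
proof (induction arbitrary: s rule: dyck_cong.induct)
  case (left u v w)
  then have "stack_act0 u = stack_act0 v" by blast
  then show ?case by (simp add: stack_act0_mult)
next
  case (right u v w)
  then show ?case by (simp add: stack_act0_mult)
qed (auto simp: stack_act0_def)

lemma stack_act_dyck_language:
  assumes "w \<in> lists (alphabet m)" "stack_act w s \<noteq> None"
  shows "w \<in> dyck_language m"
  using assms dyck_cong_stack_act[of m "Some w" None s]
  by (auto simp: dyck_language_def stack_act0_def)

text \<open>\<open>eps\<close> is the case \<open>c = height z (n + 1)\<close>; a free threshold
  also reaches the deeper symbols of the stack.\<close>

definition last_below :: "(int \<Rightarrow> int) \<Rightarrow> int \<Rightarrow> int \<Rightarrow> int" where
  "last_below z n c = (GREATEST l. l < n \<and> height z l \<le> c)"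

lemma S_infD:
  assumes "z \<in> S_inf"
  shows "z n = 0 \<or> z n = 1" "\<exists>l\<le>0. height z l \<le> - int k"
  using assms by (auto simp: S_inf_eq space_mu1)

lemma height_step:
  assumes "z \<in> S_inf"
  shows "height z (n + 1) = height z n + (if z n = 1 then 1 else - 1)"
  using S_infD(1)[OF assms, of n] by (auto simp: height_Suc)

lemma last_below_unique:
  assumes "l < n" "height z l \<le> c" "\<And>u. l < u \<Longrightarrow> u < n \<Longrightarrow> c < height z u"
  shows "last_below z n c = l"
  unfolding last_below_def
proof (rule Greatest_equality)
  show "y \<le> l" if "y < n \<and> height z y \<le> c" for y
    using that assms(3)[of y] by linarith
qed (use assms in simp)

lemma last_below:
  assumes z: "z \<in> S_inf"
  shows last_below_less: "last_below z n c < n"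
    and height_last_below_le: "height z (last_below z n c) \<le> c"
    and above_last_below: "last_below z n c < u \<Longrightarrow> u < n \<Longrightarrow> c < height z u"
proof -
  \<comment> \<open>Low enough to be below \<open>c\<close> and, since \<open>abs_height_le\<close>
    turns a low height into a distant position, to lie left of \<open>n\<close>.\<close>
  obtain l where l: "l \<le> 0" "height z l \<le> - int (nat \<bar>c\<bar> + nat \<bar>n\<bar> + 1)"
    using S_infD(2)[OF z] by blast
  have "l < n" "height z l \<le> c" using l abs_height_le[of z l] by linarith+
  let ?A = "{l..<n} \<inter> {u. height z u \<le> c}"
  have fin: "finite ?A" by simp
  have "l \<in> ?A" using \<open>l < n\<close> \<open>height z l \<le> c\<close> by simp
  then have ne: "?A \<noteq> {}" by blast
  have M: "Max ?A \<in> ?A" by (rule Max_in[OF fin ne])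
  have above: "c < height z u" if "Max ?A < u" "u < n" for u
  proof (rule ccontr)
    assume "\<not> c < height z u"
    then have "u \<in> ?A" using that M by auto
    then have "u \<le> Max ?A" by (rule Max_ge[OF fin])
    with that show False by simp
  qed
  have "last_below z n c = Max ?A"
    by (rule last_below_unique) (use M above in auto)
  then show "last_below z n c < n" "height z (last_below z n c) \<le> c"
    "last_below z n c < u \<Longrightarrow> u < n \<Longrightarrow> c < height z u"
    using M above by auto
qed

text \<open>Heights change by one, so after the last visit to level \<open>c\<close> or below, the
  walk can exceed \<open>c\<close> only by stepping up from exactly \<open>c\<close>.\<close>

lemma last_below_step:
  assumes z: "z \<in> S_inf" and n: "c < height z n"
  shows height_last_below: "height z (last_below z n c) = c"
    and bit_last_below: "z (last_below z n c) = 1"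
proof -
  let ?l = "last_below z n c"
  have "c < height z (?l + 1)"
    using above_last_below[OF z, of n c "?l + 1"] last_below_less[OF z, of n c] n
    by (cases "?l + 1 = n") auto
  then show "height z ?l = c" "z ?l = 1"
    using height_last_below_le[OF z, of n c] height_step[OF z, of ?l] by (auto split: if_splits)
qed

lemma eps_eq_last_below: "eps z n = last_below z n (height z (n + 1))"
  by (simp add: eps_def last_below_def)

text \<open>Labels of the symbols \<alpha> still open just before time n, top first: the one at
  depth k was pushed when the walk last left the level \<open>height z n - 1 - k\<close>. On
  \<open>S_inf\<close> there are infinitely many, since the height is unbounded below on the
  left.\<close>

definition stack :: "(int \<Rightarrow> int) \<Rightarrow> (int \<Rightarrow> nat) \<Rightarrow> int \<Rightarrow> nat \<Rightarrow> nat" where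
  "stack z a n k = a (gam z (last_below z n (height z n - 1 - int k)))"

text \<open>A position whose height exceeds \<open>c\<close> does not affect
  \<open>last_below\<close> at \<open>c\<close>, so the old entries only move down by one. The same
  observation drives \<open>stack_pop\<close>.\<close>

lemma stack_push:
  assumes z: "z \<in> S_inf" and n: "z n = 1"
  shows "stack z a (n + 1) = case_nat (a (gam z n)) (stack z a n)"
proof
  fix k
  have h: "height z (n + 1) = height z n + 1" using height_step[OF z, of n] n by simp
  show "stack z a (n + 1) k = case_nat (a (gam z n)) (stack z a n) k"
  proof (cases k)
    case 0
    have "last_below z (n + 1) (height z n) = n" by (rule last_below_unique) auto
    with 0 show ?thesis by (simp add: stack_def h)
  next
    case (Suc j)
    let ?c = "height z n - 1 - int j"
    have above: "?c < height z u" if "last_below z n ?c < u" "u < n + 1" for u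
    proof (cases "u = n")
      case False
      with that show ?thesis using above_last_below[OF z, of n ?c u] by linarith
    qed simp
    have "last_below z (n + 1) ?c = last_below z n ?c"
      using last_below_less[OF z, of n ?c] height_last_below_le[OF z, of n ?c] above
      by (intro last_below_unique) linarith+
    moreover have "height z (n + 1) - 1 - int k = ?c" using h Suc by simp
    ultimately show ?thesis using Suc by (simp only: stack_def nat.case)
  qed
qed

lemma stack_pop:
  assumes z: "z \<in> S_inf" and n: "z n = 0"
  shows "stack z a (n + 1) = (\<lambda>k. stack z a n (Suc k))" and "a (gam z (eps z n)) = stack z a n 0"
proof -
  have h: "height z (n + 1) = height z n - 1" using height_step[OF z, of n] n by simp
  show "a (gam z (eps z n)) = stack z a n 0" by (simp add: stack_def eps_eq_last_below h)
  show "stack z a (n + 1) = (\<lambda>k. stack z a n (Suc k))"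
  proof
    fix k
    let ?c = "height z n - 2 - int k"
    have above: "?c < height z u" if "last_below z n ?c < u" "u < n + 1" for u
    proof (cases "u = n")
      case False
      with that show ?thesis using above_last_below[OF z, of n ?c u] by linarith
    qed simp
    have "last_below z (n + 1) ?c = last_below z n ?c"
      using last_below_less[OF z, of n ?c] height_last_below_le[OF z, of n ?c] above
      by (intro last_below_unique) linarith+
    moreover have "height z (n + 1) - 1 - int k = ?c" "height z n - 1 - int (Suc k) = ?c"
      using h by simp_all
    ultimately show "stack z a (n + 1) k = stack z a n (Suc k)" by (simp only: stack_def)
  qed
qed

text \<open>The letter at r carries \<open>stack z a r\<close> to \<open>stack z a (r + 1)\<close>:
  each \<beta> finds its own label on top, so the action never fails.\<close>

lemma stack_act_dyck_code:
  assumes z: "z \<in> S_inf"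
  shows "stack_act (map (dyck_code (z, a)) [r..l]) (stack z a r) \<noteq> None"
proof (induction r l rule: upto.induct)
  case (1 r l)
  show ?case
  proof (cases "r \<le> l")
    case True
    have "stack_act (map (dyck_code (z, a)) [r..l]) (stack z a r)
        = stack_act (map (dyck_code (z, a)) [r + 1..l]) (stack z a (r + 1))"
      using S_infD(1)[OF z, of r] True
      by (auto simp: upto_rec1 dyck_code_def stack_push[OF z] stack_pop[OF z])
    then show ?thesis using "1.IH"[OF True] by simp
  qed simp
qed

lemma dyck_code_in_dyck_shift:
  assumes z: "z \<in> S_inf" and a: "\<And>j. a j \<in> {1..m}"
  shows "dyck_code (z, a) \<in> dyck_shift m"
proof -
  have alphabet: "dyck_code (z, a) n \<in> alphabet m" for n
    using a by (auto simp: dyck_code_def alphabet_def)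
  then have "map (dyck_code (z, a)) [r..l] \<in> lists (alphabet m)" for r l
    by auto
  then show ?thesis
    unfolding dyck_shift_def
    using alphabet stack_act_dyck_language[OF _ stack_act_dyck_code[OF z, of a]] by blast
qed


section \<open>Matched positions\<close>

text \<open>The \<alpha> matched to the letter at n, an \<alpha> being matched to itself, so that
  both kinds of letter read their label in the same way.\<close>

definition partner :: "(int \<Rightarrow> int) \<Rightarrow> int \<Rightarrow> int" where
  "partner z n = (if z n = 1 then n else eps z n)"

lemma dyck_code_partner:
  "dyck_code (z, a) n = (if z n = 1 then Alpha else Beta) (a (gam z (partner z n)))"
  by (simp add: dyck_code_def partner_def)

lemma eps:
  assumes z: "z \<in> S_inf" and n: "z n = 0"
  shows eps_less: "eps z n < n" and height_eps: "height z (eps z n) = height z (n + 1)"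
    and bit_eps: "z (eps z n) = 1"
    and above_eps: "eps z n < u \<Longrightarrow> u < n \<Longrightarrow> height z (n + 1) < height z u"
proof -
  have "height z (n + 1) < height z n" using height_step[OF z, of n] n by simp
  then show "eps z n < n" "height z (eps z n) = height z (n + 1)" "z (eps z n) = 1"
    "eps z n < u \<Longrightarrow> u < n \<Longrightarrow> height z (n + 1) < height z u"
    using last_below_less[OF z] height_last_below[OF z] bit_last_below[OF z] above_last_below[OF z]
    by (auto simp: eps_eq_last_below)
qed

lemma bit_partner: "z \<in> S_inf \<Longrightarrow> z (partner z n) = 1"
  using S_infD(1)[of z n] bit_eps[of z n] by (auto simp: partner_def)

text \<open>\<open>gam\<close> numbers the ones in order, by 1, 2, ... from the origin on and by -1,
  -2, ... going left. So different partners read different, hence independent, coordinates of the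
  label sequence.\<close>

lemma gam_strict_mono_on_ones:
  assumes z: "\<And>n. z n = 0 \<or> z n = 1" and "z i = 1" "z j = 1" "i < j"
  shows "gam z i < gam z j"
proof -
  have z0: "0 \<le> z n" for n using z[of n] by auto
  consider "0 \<le> i" | "i < 0" "0 \<le> j" | "j < 0" by linarith
  then show ?thesis
  proof cases
    case 1
    have "sum z (insert j {0..i}) \<le> sum z {0..j}"
      using 1 assms by (intro sum_mono2) (auto simp: z0)
    then show ?thesis using 1 assms by (simp add: gam_def)
  next
    case 2
    have "sum z {i} \<le> sum z {i..-1}" using 2 by (intro sum_mono2) (auto simp: z0)
    moreover have "0 \<le> sum z {0..j}" by (intro sum_nonneg) (simp add: z0)
    ultimately show ?thesis using 2 assms by (simp add: gam_def)
  next
    case 3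
    have "sum z (insert i {j..-1}) \<le> sum z {i..-1}"
      using 3 assms by (intro sum_mono2) (auto simp: z0)
    then show ?thesis using 3 assms by (simp add: gam_def)
  qed
qed

lemma gam_partner_eq_iff:
  assumes z: "z \<in> S_inf"
  shows "gam z (partner z n) = gam z (partner z k) \<longleftrightarrow> partner z n = partner z k"
proof -
  have "gam z (partner z i) < gam z (partner z j)" if "partner z i < partner z j" for i j
    using S_infD(1)[OF z] bit_partner[OF z] bit_partner[OF z] that
    by (rule gam_strict_mono_on_ones)
  from this[of n k] this[of k n] show ?thesis
    by (cases "partner z n" "partner z k" rule: linorder_cases) auto
qed

text \<open>Two letters share a partner only as a matched pair, never as two symbols \<beta>. The
  criterion looks only at bits and heights from \<open>k\<close> to \<open>n + 1\<close>; this
  locality is what \<open>partner_eq_transfer\<close> exploits.\<close>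

lemma partner_eq_iff:
  assumes z: "z \<in> S_inf" and "k < n"
  shows "partner z k = partner z n \<longleftrightarrow> z k = 1 \<and> z n = 0 \<and> height z k \<le> height z (n + 1)
    \<and> (\<forall>u. k < u \<and> u < n \<longrightarrow> height z (n + 1) < height z u)"
proof
  assume eq: "partner z k = partner z n"
  have n: "z n = 0"
  proof (rule ccontr)
    assume "z n \<noteq> 0"
    then have "partner z k = n" using S_infD(1)[OF z, of n] eq by (simp add: partner_def)
    moreover have "partner z k \<le> k"
      using S_infD(1)[OF z, of k] eps_less[OF z, of k] by (auto simp: partner_def)
    ultimately show False using \<open>k < n\<close> by simp
  qed
  have k: "z k = 1"
  proof (rule ccontr)
    assume "z k \<noteq> 1"
    then have k: "z k = 0" using S_infD(1)[OF z, of k] by simp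
    with n eq have eq': "eps z k = eps z n" by (simp add: partner_def)
    then have h: "height z (k + 1) = height z (n + 1)" using height_eps[OF z] k n by metis
    \<comment> \<open>Two symbols \<beta> with one partner would end at the same height. But the end
      of the earlier one is either n, from which the walk steps down, or lies strictly between the
      partner and n, where heights are larger.\<close>
    show False
    proof (cases "k + 1 = n")
      case True
      then show False using h height_step[OF z, of n] n by simp
    next
      case False
      then have "height z (n + 1) < height z (k + 1)"
        using above_eps[OF z n, of "k + 1"] eps_less[OF z k] eq' \<open>k < n\<close> by simp
      with h show False by simp
    qed
  qed
  then have "eps z n = k" using eq n by (simp add: partner_def)
  then show "z k = 1 \<and> z n = 0 \<and> height z k \<le> height z (n + 1)
      \<and> (\<forall>u. k < u \<and> u < n \<longrightarrow> height z (n + 1) < height z u)"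
    using k n height_eps[OF z n] above_eps[OF z n] by auto
next
  assume *: "z k = 1 \<and> z n = 0 \<and> height z k \<le> height z (n + 1)
    \<and> (\<forall>u. k < u \<and> u < n \<longrightarrow> height z (n + 1) < height z u)"
  then have "eps z n = k"
    unfolding eps_eq_last_below using \<open>k < n\<close> by (intro last_below_unique) auto
  with * show "partner z k = partner z n" by (simp add: partner_def)
qed

lemma height_diff_eq:
  assumes z: "z \<in> S_inf" and z': "z' \<in> S_inf"
    and eq: "\<And>t. t < n \<Longrightarrow> z (i + int t) = z' (i' + int t)" and "t \<le> n"
  shows "height z (i + int t) - height z i = height z' (i' + int t) - height z' i'"
  using \<open>t \<le> n\<close>
proof (induction t)
  case (Suc t)
  then show ?case
    using eq[of t] height_step[OF z, of "i + int t"] height_step[OF z', of "i' + int t"]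
    by (simp add: add_ac)
qed simp

text \<open>The criterion of \<open>partner_eq_iff\<close> compares heights inside the window only,
  and their differences are fixed by its bits. So the matching pattern of a block ignores everything
  outside it.\<close>

lemma partner_eq_transfer:
  assumes z: "z \<in> S_inf" and z': "z' \<in> S_inf"
    and eq: "\<And>t. t < n \<Longrightarrow> z (i + int t) = z' (i' + int t)" and "t < n" "t' < n"
  shows "partner z (i + int t) = partner z (i + int t')
    \<longleftrightarrow> partner z' (i' + int t) = partner z' (i' + int t')"
proof -
  \<comment> \<open>Offsets replace positions and heights are taken relative to the left end, so
    that \<open>height_diff_eq\<close> applies.\<close>
  have *: "partner z (i + int t) = partner z (i + int t') \<longleftrightarrow>
    z (i + int t) = 1 \<and> z (i + int t') = 0
    \<and> height z (i + int t) - height z i \<le> height z (i + int (Suc t')) - height z i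
    \<and> (\<forall>s. t < s \<and> s < t' \<longrightarrow> height z (i + int (Suc t')) - height z i < height z (i + int s) - height z i)"
    if "z \<in> S_inf" "t < t'" for z i t t'
  proof -
    have "(\<forall>u. i + int t < u \<and> u < i + int t' \<longrightarrow> height z (i + int (Suc t')) < height z u)
        \<longleftrightarrow> (\<forall>s. t < s \<and> s < t' \<longrightarrow> height z (i + int (Suc t')) < height z (i + int s))"
      (is "?L \<longleftrightarrow> ?R")
    proof
      assume R: ?R
      show ?L
      proof safe
        fix u assume u: "i + int t < u" "u < i + int t'"
        then have "t < nat (u - i)" "nat (u - i) < t'" "i + int (nat (u - i)) = u" by linarith+
        then show "height z (i + int (Suc t')) < height z u" using R by metis
      qed
    qed simp
    then show ?thesis
      using partner_eq_iff[OF that(1), of "i + int t" "i + int t'"] that(2) by (simp add: add_ac)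
  qed
  have **: "partner z (i + int t) = partner z (i + int t')
    \<longleftrightarrow> partner z' (i' + int t) = partner z' (i' + int t')" if "t < t'" "t' < n" for t t'
  proof -
    have d: "height z (i + int s) - height z i = height z' (i' + int s) - height z' i'" if "s \<le> n" for s
      by (rule height_diff_eq[OF z z' eq that])
    show ?thesis
      unfolding *[OF z that(1)] *[OF z' that(1)]
      using that d[of t] d[of "Suc t'"] d eq[of t] eq[of t'] by (auto simp del: of_nat_Suc)
  qed
  show ?thesis
    using **[of t t'] **[of t' t] assms(4,5) by (cases t t' rule: linorder_cases) auto
qed

text \<open>Blocks of bits are stored with the most recent bit first. \<open>depth\<close> counts the symbols
  \<open>\<alpha>\<close> of a block that are still open at its end, and \<open>cells\<close> the distinct labels that a block sees.\<close>
fun depth :: "bool list \<Rightarrow> nat" where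
  "depth [] = 0"
| "depth (b # bs) = (if b then depth bs + 1 else depth bs - 1)"

fun cells :: "bool list \<Rightarrow> nat" where
  "cells [] = 0"
| "cells (b # bs) = cells bs + of_bool (b \<or> depth bs = 0)"

definition bits :: "(int \<Rightarrow> int) \<Rightarrow> int \<Rightarrow> nat \<Rightarrow> bool list" where
  "bits z i n = rev (map (\<lambda>t. z (i + int t) = 1) [0..<n])"

lemma bits_simps: "bits z i 0 = []" "bits z i (Suc n) = (z (i + int n) = 1) # bits z i n"
  by (simp_all add: bits_def)

text \<open>\<open>depth\<close> is the height above the minimum over the window: the truncated
  subtraction holds it at 0 exactly when the walk steps to a new minimum.\<close>

lemma depth_bits:
  assumes z: "z \<in> S_inf"
  shows "(\<exists>t\<le>n. height z (i + int t) = height z (i + int n) - int (depth (bits z i n)))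
    \<and> (\<forall>t\<le>n. height z (i + int n) - int (depth (bits z i n)) \<le> height z (i + int t))"
proof (induction n)
  case 0
  then show ?case by (simp add: bits_simps)
next
  case (Suc n)
  let ?d = "depth (bits z i n)"
  have h: "height z (i + int (Suc n)) = height z (i + int n) + (if z (i + int n) = 1 then 1 else - 1)"
    using height_step[OF z, of "i + int n"] by (simp add: add_ac)
  obtain t where t: "t \<le> n" "height z (i + int t) = height z (i + int n) - int ?d"
    and min: "\<And>t. t \<le> n \<Longrightarrow> height z (i + int n) - int ?d \<le> height z (i + int t)"
    using Suc by blast
  show ?case
  proof (cases "z (i + int n) = 1 \<or> ?d > 0")
    case True
    then have eq: "height z (i + int (Suc n)) - int (depth (bits z i (Suc n))) = height z (i + int n) - int ?d"
      unfolding h by (auto simp: bits_simps)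
    have "height z (i + int n) - int ?d \<le> height z (i + int t')" if "t' \<le> Suc n" for t'
    proof (cases "t' = Suc n")
      case True
      then show ?thesis using eq by (metis diff_le_eq le_add_same_cancel1 of_nat_0_le_iff)
    qed (use that min in simp)
    then show ?thesis unfolding eq using t by (auto intro: le_SucI)
  next
    case False
    then have d: "depth (bits z i (Suc n)) = 0" "?d = 0" and h': "height z (i + int (Suc n)) = height z (i + int n) - 1"
      unfolding h by (auto simp: bits_simps)
    have "height z (i + int (Suc n)) \<le> height z (i + int t')" if "t' \<le> Suc n" for t'
    proof (cases "t' = Suc n")
      case False
      then show ?thesis using that min[of t'] h' d(2) by simp
    qed simp
    then show ?thesis unfolding d by auto
  qed
qed

text \<open>A new letter adds a position unless it is a \<beta> whose \<alpha> lies in the window,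
  which by \<open>depth_bits\<close> means positive depth.\<close>

lemma card_partners:
  assumes z: "z \<in> S_inf"
  shows "card ((\<lambda>t. partner z (i + int t)) ` {..<n}) = cells (bits z i n)"
proof (induction n)
  case (Suc n)
  let ?I = "(\<lambda>t. partner z (i + int t)) ` {..<n}"
  have "partner z (i + int n) \<in> ?I \<longleftrightarrow> \<not> (z (i + int n) = 1 \<or> depth (bits z i n) = 0)"
  proof (cases "z (i + int n) = 1")
    case True
    have "partner z (i + int t) \<noteq> partner z (i + int n)" if "t < n" for t
      using partner_eq_iff[OF z, of "i + int t" "i + int n"] that True by simp
    then show ?thesis using True by (metis (no_types, lifting) imageE lessThan_iff)
  next
    case False
    then have n0: "z (i + int n) = 0" using S_infD(1)[OF z, of "i + int n"] by simp
    then have h: "height z (i + int n + 1) = height z (i + int n) - 1"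
      using height_step[OF z, of "i + int n"] by simp
    have p: "partner z (i + int n) = eps z (i + int n)" using n0 by (simp add: partner_def)
    show ?thesis
    proof (cases "depth (bits z i n) = 0")
      case True
      have "partner z (i + int t) \<noteq> partner z (i + int n)" if "t < n" for t
      proof
        assume "partner z (i + int t) = partner z (i + int n)"
        then have "height z (i + int t) \<le> height z (i + int n) - 1"
          using partner_eq_iff[OF z, of "i + int t" "i + int n"] that h by simp
        moreover have "height z (i + int n) \<le> height z (i + int t)"
          using depth_bits[OF z, of n i] True that by simp
        ultimately show False by simp
      qed
      then show ?thesis using True by (metis (no_types, lifting) imageE lessThan_iff)
    next
      case False
      obtain t where t: "t \<le> n" "height z (i + int t) = height z (i + int n) - int (depth (bits z i n))"
        using depth_bits[OF z, of n i] by blast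
      then have "t < n" using False by (cases "t = n") auto
      \<comment> \<open>The minimum attained at t is at most the level reached after the pop, so the
        last visit to that level or below is not left of t.\<close>
      have "i + int t \<le> eps z (i + int n)"
      proof (rule ccontr)
        assume "\<not> i + int t \<le> eps z (i + int n)"
        then have "height z (i + int n + 1) < height z (i + int t)"
          using above_eps[OF z n0, of "i + int t"] \<open>t < n\<close> by simp
        then show False using t(2) h False by simp
      qed
      then have e: "i + int (nat (eps z (i + int n) - i)) = eps z (i + int n)"
        "nat (eps z (i + int n) - i) < n"
        using eps_less[OF z n0] by linarith+
      have "partner z (eps z (i + int n)) = eps z (i + int n)"
        using bit_eps[OF z n0] by (simp add: partner_def)
      then have "eps z (i + int n) \<in> ?I"
        using e by (intro image_eqI[of _ _ "nat (eps z (i + int n) - i)"]) auto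
      then show ?thesis using False n0 p by simp
    qed
  qed
  then have "card (insert (partner z (i + int n)) ?I) = cells (bits z i (Suc n))"
    using Suc by (auto simp: card_insert_if bits_simps)
  then show ?case by (simp add: lessThan_Suc)
qed (simp add: bits_simps)

section \<open>The law of a block\<close>

lemma prob_space_mu2: "m \<ge> 1 \<Longrightarrow> prob_space (mu2 m)"
  unfolding mu2_def by (rule prob_space_uniform_PiM) auto

lemma space_mu2: "space (mu2 m) = {a. \<forall>n. a n \<in> {1..m}}"
  by (simp add: mu2_def space_uniform_PiM)

lemma mu2_component: "(\<lambda>a. a i) \<in> measurable (mu2 m) (count_space UNIV)"
  unfolding mu2_def by (rule uniform_PiM_component_measurable) simp

section \<open>Measurability of the coding map\<close>

definition coding_space :: "nat \<Rightarrow> ((int \<Rightarrow> int) \<times> (int \<Rightarrow> nat)) measure" where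
  "coding_space m = restrict_space (mu1 \<Otimes>\<^sub>M mu2 m) (S_inf \<times> space (mu2 m))"

lemma coding_domain_sets: "S_inf \<times> space (mu2 m) \<in> sets (mu1 \<Otimes>\<^sub>M mu2 m)"
  using S_inf_sets by auto

lemma space_coding_space: "space (coding_space m) = S_inf \<times> space (mu2 m)"
  using sets.sets_into_space[OF coding_domain_sets[of m]]
  by (auto simp: coding_space_def space_restrict_space)

lemma coding_space_fst: "fst \<in> measurable (coding_space m) (restrict_space mu1 S_inf)"
proof (rule measurable_restrict_space2)
  show "fst \<in> space (coding_space m) \<rightarrow> S_inf" by (auto simp: space_coding_space)
  show "fst \<in> measurable (coding_space m) mu1"
    unfolding coding_space_def by (intro measurable_restrict_space1 measurable_fst)
qed

lemma coding_space_label: "(\<lambda>p. snd p i) \<in> measurable (coding_space m) (count_space UNIV)"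
  unfolding coding_space_def
  by (rule measurable_restrict_space1) (rule measurable_compose[OF measurable_snd mu2_component])

lemma measurable_count_space_gam: "(\<lambda>z. gam z k) \<in> measurable mu1 (count_space UNIV)"
proof -
  have sum: "(\<lambda>z. \<Sum>i\<in>J. z i) \<in> measurable mu1 (count_space UNIV)" if "finite J" for J :: "int set"
    using that
  proof induction
    case (insert j J)
    then show ?case
      using measurable_count_space_binop[OF mu1_component[of j] insert.IH, of "(+)"] by simp
  qed simp
  then have "(\<lambda>z. - (\<Sum>i\<in>J. z i)) \<in> measurable mu1 (count_space UNIV)" if "finite J" for J :: "int set"
    using measurable_compose[OF sum[OF that], of uminus "count_space UNIV"] by simp
  with sum show ?thesis by (cases "k \<ge> 0") (simp_all add: gam_def)
qed

text \<open>Replaces \<open>GREATEST\<close> by countably many comparisons of heights, from which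
  measurability can be read off.\<close>

lemma eps_eq_iff:
  assumes z: "z \<in> S_inf"
  shows "eps z n = l \<longleftrightarrow> l < n \<and> height z l \<le> height z (n + 1)
    \<and> (\<forall>u. l < u \<and> u < n \<longrightarrow> height z (n + 1) < height z u)"
proof
  assume "eps z n = l"
  then show "l < n \<and> height z l \<le> height z (n + 1)
      \<and> (\<forall>u. l < u \<and> u < n \<longrightarrow> height z (n + 1) < height z u)"
    using last_below[OF z, of n "height z (n + 1)"] unfolding eps_eq_last_below by blast
next
  assume "l < n \<and> height z l \<le> height z (n + 1)
    \<and> (\<forall>u. l < u \<and> u < n \<longrightarrow> height z (n + 1) < height z u)"
  then show "eps z n = l" unfolding eps_eq_last_below by (intro last_below_unique) auto
qed

lemma measurable_eps: "(\<lambda>z. eps z n) \<in> measurable (restrict_space mu1 S_inf) (count_space UNIV)"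
proof -
  let ?N = "restrict_space mu1 S_inf"
  have sp: "space ?N = S_inf" using S_inf_sets sets.sets_into_space
    by (auto simp: space_restrict_space)
  have h: "(\<lambda>z. height z i) \<in> measurable ?N (count_space UNIV)" for i
    by (rule measurable_restrict_space1[OF height_measurable])
  have cmp: "{z \<in> space ?N. P (height z i) (height z j)} \<in> sets ?N" for P i j
    using Collect_count_space_sets[OF measurable_count_space_binop[OF h[of i] h[of j], of Pair],
        of "case_prod P"] by simp
  have "(\<lambda>z. eps z n) -` {l} \<inter> space ?N \<in> sets ?N" for l
  proof -
    have "(\<lambda>z. eps z n) -` {l} \<inter> space ?N = {z \<in> space ?N. l < n \<and> height z l \<le> height z (n + 1)
        \<and> (\<forall>u. (l < u \<and> u < n) \<longrightarrow> height z (n + 1) < height z u)}"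
      using eps_eq_iff by (auto simp: sp)
    also have "\<dots> \<in> sets ?N"
      by (intro sets.sets_Collect_conj sets.sets_Collect_countable_All sets.sets_Collect_imp
          sets.sets_Collect_const cmp)
    finally show ?thesis .
  qed
  then show ?thesis by (subst measurable_count_space_eq2_countable) auto
qed

lemma measurable_gam_partner:
  "(\<lambda>z. gam z (partner z n)) \<in> measurable (restrict_space mu1 S_inf) (count_space UNIV)"
proof (rule measurable_compose_countable[OF measurable_restrict_space1[OF measurable_count_space_gam]])
  have z: "(\<lambda>z. z n) \<in> measurable (restrict_space mu1 S_inf) (count_space UNIV)"
    by (rule measurable_restrict_space1[OF mu1_component])
  show "(\<lambda>z. partner z n) \<in> measurable (restrict_space mu1 S_inf) (count_space UNIV)"
    using measurable_count_space_binop[OF z measurable_eps[of n], of "\<lambda>v e. if v = 1 then n else e"]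
    by (simp add: partner_def)
qed

lemma measurable_dyck_code_component:
  "(\<lambda>p. dyck_code p n) \<in> measurable (coding_space m) (count_space UNIV)"
proof -
  have z: "(\<lambda>z. z n) \<in> measurable (restrict_space mu1 S_inf) (count_space UNIV)"
    by (rule measurable_restrict_space1[OF mu1_component])
  \<comment> \<open>The coordinate read from the label sequence is itself random, but takes
    countably many values.\<close>
  have "(\<lambda>p. snd p (gam (fst p) (partner (fst p) n))) \<in> measurable (coding_space m) (count_space UNIV)"
    by (rule measurable_compose_countable[where g = "\<lambda>p. gam (fst p) (partner (fst p) n)",
          OF coding_space_label measurable_compose[OF coding_space_fst measurable_gam_partner]])
  from measurable_count_space_binop[OF measurable_compose[OF coding_space_fst z] this,
      of "\<lambda>v j. (if v = 1 then Alpha else Beta) j"]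
  moreover have "(\<lambda>p. dyck_code p n) = (\<lambda>p. (if fst p n = 1 then Alpha else Beta)
      (snd p (gam (fst p) (partner (fst p) n))))"
    by (simp add: fun_eq_iff split_paired_All dyck_code_partner)
  ultimately show ?thesis by simp
qed

lemma dyck_shift_subset: "dyck_shift m \<subseteq> space (PiM UNIV (\<lambda>_. count_space (alphabet m)))"
  by (auto simp: dyck_shift_def space_PiM)

lemma space_dyck_space: "space (dyck_space m) = dyck_shift m"
  using dyck_shift_subset[of m] by (auto simp: dyck_space_def space_restrict_space)

lemma finite_alphabet: "finite (alphabet m)"
  by (simp add: alphabet_def)

lemma measurable_dyck_code: "dyck_code \<in> measurable (coding_space m) (dyck_space m)"
  unfolding dyck_space_def
proof (rule measurable_restrict_space2)
  show *: "dyck_code \<in> space (coding_space m) \<rightarrow> dyck_shift m"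
    using dyck_code_in_dyck_shift by (auto simp: space_coding_space space_mu2)
  have "(\<lambda>p n. dyck_code p n) \<in> measurable (coding_space m) (PiM UNIV (\<lambda>_. count_space (alphabet m)))"
  proof (rule measurable_PiM_single')
    fix n
    have "(\<lambda>p. dyck_code p n) \<in> space (coding_space m) \<rightarrow> alphabet m"
      using * by (auto simp: dyck_shift_def)
    moreover have "(\<lambda>p. dyck_code p n) -` {c} \<inter> space (coding_space m) \<in> sets (coding_space m)" for c
      using measurable_sets[OF measurable_dyck_code_component] by simp
    ultimately show "(\<lambda>p. dyck_code p n) \<in> measurable (coding_space m) (count_space (alphabet m))"
      by (subst measurable_count_space_eq2[OF finite_alphabet]) auto
  next
    show "(\<lambda>p n. dyck_code p n) \<in> space (coding_space m) \<rightarrow> (\<Pi>\<^sub>E n\<in>UNIV. space (count_space (alphabet m)))"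
      using * by (auto simp: dyck_shift_def PiE_def)
  qed
  then show "dyck_code \<in> measurable (coding_space m) (PiM UNIV (\<lambda>_. count_space (alphabet m)))"
    by simp
qed

lemma mu_tilde_eq: "mu_tilde m = distr (coding_space m) (dyck_space m) dyck_code"
  by (simp add: mu_tilde_def coding_space_def)

lemma sets_mu_tilde: "sets (mu_tilde m) = sets (dyck_space m)"
  by (simp add: mu_tilde_eq)

lemma space_mu_tilde: "space (mu_tilde m) = dyck_shift m"
  by (simp add: mu_tilde_eq space_dyck_space)

lemma emeasure_mu_tilde:
  assumes "A \<in> sets (mu_tilde m)"
  shows "emeasure (mu_tilde m) A
    = emeasure (mu1 \<Otimes>\<^sub>M mu2 m) {p \<in> S_inf \<times> space (mu2 m). dyck_code p \<in> A}"
    and "{p \<in> S_inf \<times> space (mu2 m). dyck_code p \<in> A} \<in> sets (mu1 \<Otimes>\<^sub>M mu2 m)"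
proof -
  let ?E = "{p \<in> S_inf \<times> space (mu2 m). dyck_code p \<in> A}"
  have E: "dyck_code -` A \<inter> space (coding_space m) = ?E"
    by (auto simp: space_coding_space)
  have "?E \<in> sets (coding_space m)"
    using measurable_sets[OF measurable_dyck_code] assms unfolding sets_mu_tilde E[symmetric] by blast
  then show "?E \<in> sets (mu1 \<Otimes>\<^sub>M mu2 m)"
    unfolding coding_space_def
    by (subst (asm) sets_restrict_space_iff) (use coding_domain_sets sets.sets_into_space in auto)
  have "emeasure (mu_tilde m) A = emeasure (coding_space m) ?E"
    unfolding mu_tilde_eq using assms
    by (subst emeasure_distr[OF measurable_dyck_code]) (simp_all add: sets_mu_tilde E)
  also have "\<dots> = emeasure (mu1 \<Otimes>\<^sub>M mu2 m) ?E"
    unfolding coding_space_def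
    by (rule emeasure_restrict_space)
      (use coding_domain_sets sets.sets_into_space in \<open>auto simp: Int_absorb2\<close>)
  finally show "emeasure (mu_tilde m) A = emeasure (mu1 \<Otimes>\<^sub>M mu2 m) ?E" .
qed

section \<open>Probabilities of words\<close>

fun is_alpha :: "letter \<Rightarrow> bool" where
  "is_alpha (Alpha j) = True"
| "is_alpha (Beta j) = False"

fun letter_label :: "letter \<Rightarrow> nat" where
  "letter_label (Alpha j) = j"
| "letter_label (Beta j) = j"

lemma letter_label_alphabet: "c \<in> alphabet m \<Longrightarrow> letter_label c \<in> {1..m}"
  by (auto simp: alphabet_def)

lemma dyck_code_eq_iff:
  "dyck_code (z, a) n = c
    \<longleftrightarrow> (z n = 1) = is_alpha c \<and> a (gam z (partner z n)) = letter_label c"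
  by (cases c) (auto simp: dyck_code_partner)

definition word_bits :: "letter list \<Rightarrow> bool list" where
  "word_bits w = rev (map is_alpha w)"

definition consistent :: "(int \<Rightarrow> int) \<Rightarrow> int \<Rightarrow> letter list \<Rightarrow> bool" where
  "consistent z i w \<longleftrightarrow> (\<forall>t<length w. \<forall>t'<length w.
     partner z (i + int t) = partner z (i + int t') \<longrightarrow> letter_label (w ! t) = letter_label (w ! t'))"

text \<open>The conditional probability of the labels of the word \<open>w\<close> given its bits.\<close>
definition word_weight :: "nat \<Rightarrow> letter list \<Rightarrow> real" where
  "word_weight m w =
    (if \<exists>z\<in>S_inf. \<exists>i. bits z i (length w) = word_bits w \<and> consistent z i w
     then (1 / real m) ^ cells (word_bits w) else 0)"

lemma bits_eq_word_bits_iff: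
  "bits z i (length w) = word_bits w \<longleftrightarrow> (\<forall>t<length w. (z (i + int t) = 1) = is_alpha (w ! t))"
proof -
  have "bits z i (length w) = word_bits w
      \<longleftrightarrow> map (\<lambda>t. z (i + int t) = 1) [0..<length w] = map is_alpha w"
    unfolding bits_def word_bits_def by (rule rev_is_rev_conv)
  also have "\<dots> \<longleftrightarrow> (\<forall>t<length w. (z (i + int t) = 1) = is_alpha (w ! t))"
    unfolding list_eq_iff_nth_eq[of "map _ _"] by simp
  finally show ?thesis .
qed

text \<open>By \<open>partner_eq_transfer\<close> consistency is a property of the word alone, once
  its bits occur. This justifies the existential in \<open>word_weight\<close>: any witness decides
  for all.\<close>

lemma consistent_transfer:
  assumes z: "z \<in> S_inf" "z' \<in> S_inf"
    and bits: "bits z i (length w) = word_bits w" "bits z' i' (length w) = word_bits w"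
  shows "consistent z i w \<longleftrightarrow> consistent z' i' w"
proof -
  have "z (i + int t) = z' (i' + int t)" if "t < length w" for t
    using bits that S_infD(1)[OF z(1), of "i + int t"] S_infD(1)[OF z(2), of "i' + int t"]
    unfolding bits_eq_word_bits_iff by auto
  from partner_eq_transfer[OF z this] show ?thesis
    unfolding consistent_def by blast
qed

text \<open>Given the bits, the word is a cylinder condition on the labels: repeated coordinates
  must carry equal labels, which is consistency, and the number of different coordinates is
  \<open>cells\<close>.\<close>

lemma emeasure_labels:
  assumes m: "m \<ge> 1" and z: "z \<in> S_inf" and w: "w \<in> lists (alphabet m)"
    and bits: "bits z i (length w) = word_bits w"
  shows "emeasure (mu2 m) {a \<in> space (mu2 m). \<forall>t<length w. dyck_code (z, a) (i + int t) = w ! t}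
    = ennreal (word_weight m w)"
proof -
  let ?\<sigma> = "\<lambda>t. gam z (partner z (i + int t))"
  have label: "letter_label (w ! t) \<in> {1..m}" if "t < length w" for t
    using w that by (intro letter_label_alphabet) (simp add: in_lists_conv_set)
  let ?S = "{a \<in> space (mu2 m). \<forall>t<length w. dyck_code (z, a) (i + int t) = w ! t}"
  have set: "?S = {a \<in> space (mu2 m). \<forall>t<length w. a (?\<sigma> t) = letter_label (w ! t)}"
    using bits by (auto simp: dyck_code_eq_iff bits_eq_word_bits_iff)
  have measure: "emeasure (mu2 m) ?S
      = (if \<forall>t<length w. \<forall>t'<length w. ?\<sigma> t = ?\<sigma> t' \<longrightarrow> letter_label (w ! t) = letter_label (w ! t')
         then ennreal ((1 / real (card {1..m})) ^ card (?\<sigma> ` {..<length w})) else 0)"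
    unfolding set unfolding mu2_def
    by (rule uniform_PiM_cylinder) (use m in simp, use m in simp, rule label)
  have consistent: "(\<forall>t<length w. \<forall>t'<length w. ?\<sigma> t = ?\<sigma> t' \<longrightarrow> letter_label (w ! t) = letter_label (w ! t'))
      \<longleftrightarrow> consistent z i w"
    by (simp only: consistent_def gam_partner_eq_iff[OF z])
  have "?\<sigma> ` {..<length w} = gam z ` (\<lambda>t. partner z (i + int t)) ` {..<length w}" by auto
  moreover have "inj_on (gam z) ((\<lambda>t. partner z (i + int t)) ` {..<length w})"
  proof (rule inj_onI)
    fix p q assume "p \<in> (\<lambda>t. partner z (i + int t)) ` {..<length w}"
      "q \<in> (\<lambda>t. partner z (i + int t)) ` {..<length w}" and "gam z p = gam z q"
    then show "p = q" by (elim imageE) (simp add: gam_partner_eq_iff[OF z])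
  qed
  ultimately have card: "card (?\<sigma> ` {..<length w}) = cells (word_bits w)"
    using card_partners[OF z, of i "length w"] bits by (simp only: card_image)
  have weight: "consistent z i w
      \<longleftrightarrow> (\<exists>z\<in>S_inf. \<exists>i. bits z i (length w) = word_bits w \<and> consistent z i w)"
  proof
    assume "consistent z i w"
    with z bits show "\<exists>z\<in>S_inf. \<exists>i. bits z i (length w) = word_bits w \<and> consistent z i w" by blast
  next
    assume "\<exists>z\<in>S_inf. \<exists>i. bits z i (length w) = word_bits w \<and> consistent z i w"
    then obtain z' i' where "z' \<in> S_inf" "bits z' i' (length w) = word_bits w" "consistent z' i' w"
      by blast
    then show "consistent z i w" using consistent_transfer[OF z _ bits] by simp
  qed
  show ?thesis
    unfolding measure consistent card word_weight_def weight[symmetric] by simp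
qed

lemma mu1_bits_block:
  assumes "length bs = n"
  shows "emeasure mu1 {z \<in> S_inf. bits z i n = bs} = ennreal (1 / 2 ^ n)"
    and "{z \<in> S_inf. bits z i n = bs} \<in> sets mu1"
proof -
  interpret prob_space mu1 by (rule prob_space_mu1)
  let ?A = "{z \<in> space mu1. map (\<lambda>t. z (i + int t) = 1) [0..<n] = rev bs}"
  have "?A = (\<lambda>z. map (\<lambda>t. z (i + int t) = 1) [0..<n]) -` {rev bs} \<inter> space mu1" by auto
  then have A: "?A \<in> sets mu1"
    using simple_functionD(2)[OF simple_function_mu1_bits[of "\<lambda>t. i + int t" 1 n], of "{rev bs}"]
    by simp
  have eq: "{z \<in> S_inf. bits z i n = bs} = S_inf \<inter> ?A"
    using S_inf_sets sets.sets_into_space by (auto simp: bits_def rev_swap)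
  then show "{z \<in> S_inf. bits z i n = bs} \<in> sets mu1" using A S_inf_sets by auto
  have "emeasure mu1 (S_inf \<inter> ?A) = emeasure mu1 ?A"
    by (rule emeasure_eq_AE) (use AE_S_inf A S_inf_sets in auto)
  also have "\<dots> = ennreal (1 / 2 ^ n)"
    using mu1_bits_prob[of "\<lambda>t. i + int t" 1 "rev bs" n] assms
    by (simp add: emeasure_eq_measure inj_def)
  finally show "emeasure mu1 {z \<in> S_inf. bits z i n = bs} = ennreal (1 / 2 ^ n)" unfolding eq .
qed

definition block :: "int \<Rightarrow> nat \<Rightarrow> (int \<Rightarrow> 'a) \<Rightarrow> 'a list" where
  "block i n x = map (\<lambda>t. x (i + int t)) [0..<n]"

lemma length_block [simp]: "length (block i n x) = n"
  by (simp add: block_def)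

lemma nth_block [simp]: "t < n \<Longrightarrow> block i n x ! t = x (i + int t)"
  by (simp add: block_def)

lemma block_eq_iff: "block i n x = w \<longleftrightarrow> length w = n \<and> (\<forall>t<n. x (i + int t) = w ! t)"
  by (auto simp: block_def list_eq_iff_nth_eq)

lemma dyck_space_component: "(\<lambda>x. x i) \<in> measurable (dyck_space m) (count_space (alphabet m))"
  unfolding dyck_space_def by (intro measurable_restrict_space1 measurable_component_singleton) simp

lemma block_in_lists: "x \<in> dyck_shift m \<Longrightarrow> block i n x \<in> lists (alphabet m)"
  by (auto simp: block_def dyck_shift_def)

lemma simple_function_block: "simple_function (mu_tilde m) (block i n)"
  unfolding simple_function_def
proof (intro conjI ballI)
  have "block i n ` space (mu_tilde m) \<subseteq> {w. set w \<subseteq> alphabet m \<and> length w = n}"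
    using block_in_lists by (fastforce simp: space_mu_tilde)
  then show "finite (block i n ` space (mu_tilde m))"
    by (rule finite_subset[OF _ finite_lists_length_eq[OF finite_alphabet]])
  fix w
  have c: "{x \<in> space (mu_tilde m). x j = c} \<in> sets (mu_tilde m)" for j c
  proof -
    have "{x \<in> space (mu_tilde m). x j = c} = (\<lambda>x. x j) -` ({c} \<inter> alphabet m) \<inter> space (dyck_space m)"
      by (auto simp: space_mu_tilde space_dyck_space dyck_shift_def)
    also have "\<dots> \<in> sets (dyck_space m)" by (rule measurable_sets[OF dyck_space_component]) simp
    finally show ?thesis by (simp add: sets_mu_tilde)
  qed
  have "block i n -` {w} \<inter> space (mu_tilde m)
      = {x \<in> space (mu_tilde m). length w = n \<and> (\<forall>t\<in>{..<n}. x (i + int t) = w ! t)}"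
    by (auto simp: block_eq_iff)
  also have "\<dots> \<in> sets (mu_tilde m)"
    by (intro sets.sets_Collect_conj sets.sets_Collect_finite_All sets.sets_Collect_const c) simp
  finally show "block i n -` {w} \<inter> space (mu_tilde m) \<in> sets (mu_tilde m)" .
qed

lemma block_sets: "{x \<in> dyck_shift m. block i n x = w} \<in> sets (mu_tilde m)"
proof -
  have "{x \<in> dyck_shift m. block i n x = w} = block i n -` {w} \<inter> space (mu_tilde m)"
    by (auto simp: space_mu_tilde)
  then show ?thesis using simple_functionD(2)[OF simple_function_block] by simp
qed

text \<open>Fubini over the bits: the section over z is empty or has measure
  \<open>word_weight\<close>, which no longer involves z. As \<open>i\<close> is absent from the
  right-hand side, shift invariance is already contained here.\<close>

lemma emeasure_block:
  assumes m: "m \<ge> 1" and w: "w \<in> lists (alphabet m)"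
  shows "emeasure (mu_tilde m) {x \<in> dyck_shift m. block i (length w) x = w}
    = ennreal (word_weight m w / 2 ^ length w)"
proof -
  interpret mu2: prob_space "mu2 m" by (rule prob_space_mu2[OF m])
  let ?n = "length w"
  let ?E = "{p \<in> S_inf \<times> space (mu2 m). dyck_code p \<in> {x \<in> dyck_shift m. block i ?n x = w}}"
  have code: "dyck_code (z, a) \<in> dyck_shift m" if "z \<in> S_inf" "a \<in> space (mu2 m)" for z a
    using dyck_code_in_dyck_shift that by (auto simp: space_mu2)
  have sect: "emeasure (mu2 m) (Pair z -` ?E)
      = ennreal (word_weight m w) * indicator {z \<in> S_inf. bits z i ?n = word_bits w} z" for z
  proof (cases "z \<in> S_inf")
    case True
    have eq: "Pair z -` ?E = {a \<in> space (mu2 m). \<forall>t<?n. dyck_code (z, a) (i + int t) = w ! t}"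
      using True code by (auto simp: block_eq_iff)
    show ?thesis
    proof (cases "bits z i ?n = word_bits w")
      case bits: True
      show ?thesis unfolding eq emeasure_labels[OF m True w bits] using True bits by simp
    next
      case False
      then have empty: "{a \<in> space (mu2 m). \<forall>t<?n. dyck_code (z, a) (i + int t) = w ! t} = {}"
        unfolding dyck_code_eq_iff bits_eq_word_bits_iff by blast
      show ?thesis unfolding eq empty using False by simp
    qed
  qed simp
  have "emeasure (mu_tilde m) {x \<in> dyck_shift m. block i ?n x = w} = emeasure (mu1 \<Otimes>\<^sub>M mu2 m) ?E"
    by (rule emeasure_mu_tilde(1)[OF block_sets])
  also have "\<dots> = (\<integral>\<^sup>+z. emeasure (mu2 m) (Pair z -` ?E) \<partial>mu1)"
    by (rule mu2.emeasure_pair_measure_alt[OF emeasure_mu_tilde(2)[OF block_sets]])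
  also have "\<dots> = ennreal (word_weight m w) * emeasure mu1 {z \<in> S_inf. bits z i ?n = word_bits w}"
    unfolding sect by (rule nn_integral_cmult_indicator[OF mu1_bits_block(2)]) (simp add: word_bits_def)
  also have "\<dots> = ennreal (word_weight m w) * ennreal (1 / 2 ^ ?n)"
    by (subst mu1_bits_block(1)) (simp_all add: word_bits_def)
  also have "\<dots> = ennreal (word_weight m w / 2 ^ ?n)"
    by (subst ennreal_mult[symmetric]) (simp_all add: word_weight_def)
  finally show ?thesis .
qed

text \<open>The letters reveal the bits of z, whose law is known, so the value comes directly from
  \<open>mu1\<close> rather than by summing word weights over labels.\<close>

lemma emeasure_word_bits:
  assumes m: "m \<ge> 1" and bs: "length bs = n"
  shows "emeasure (mu_tilde m) {x \<in> dyck_shift m. word_bits (block i n x) = bs} = ennreal (1 / 2 ^ n)"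
proof -
  interpret mu2: prob_space "mu2 m" by (rule prob_space_mu2[OF m])
  let ?A = "{x \<in> dyck_shift m. word_bits (block i n x) = bs}"
  have "simple_function (mu_tilde m) (\<lambda>x. word_bits (block i n x))"
    by (rule simple_function_compose1[OF simple_function_block])
  from simple_functionD(2)[OF this, of "{bs}"] have A: "?A \<in> sets (mu_tilde m)"
    by (simp add: vimage_def Int_def space_mu_tilde conj_commute)
  have "word_bits (block i n (dyck_code (z, a))) = bits z i n" for z a
    by (auto simp: word_bits_def block_def bits_def dyck_code_partner)
  then have "{p \<in> S_inf \<times> space (mu2 m). dyck_code p \<in> ?A} = {z \<in> S_inf. bits z i n = bs} \<times> space (mu2 m)"
    using dyck_code_in_dyck_shift by (auto simp: space_mu2)
  then have "emeasure (mu_tilde m) ?A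
      = emeasure (mu1 \<Otimes>\<^sub>M mu2 m) ({z \<in> S_inf. bits z i n = bs} \<times> space (mu2 m))"
    using emeasure_mu_tilde(1)[OF A] by simp
  also have "\<dots> = ennreal (1 / 2 ^ n)"
    using mu1_bits_block[OF bs, of i] mu2.emeasure_space_1
    by (subst mu2.emeasure_pair_measure_Times) simp_all
  finally show ?thesis .
qed

lemma prob_space_mu_tilde:
  assumes "m \<ge> 1"
  shows "prob_space (mu_tilde m)"
proof
  \<comment> \<open>The empty block imposes no condition, so the whole space has measure 1 / 2 ^
    0.\<close>
  show "emeasure (mu_tilde m) (space (mu_tilde m)) = 1"
    using emeasure_block[OF assms, of "[]" 0] mu1_bits_block(1)[of "[]" 0 0]
      emeasure_word_bits[OF assms, of "[]" 0 0]
    by (simp add: space_mu_tilde block_def word_bits_def)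
qed

section \<open>Cylinders and shift invariance\<close>

text \<open>Windows symmetric about 0 are nested, so two cylinders can be written over a common
  window; this makes \<open>cylinders\<close> an algebra.\<close>

definition cylinder :: "nat \<Rightarrow> nat \<Rightarrow> letter list set \<Rightarrow> (int \<Rightarrow> letter) set" where
  "cylinder m k B = {x \<in> dyck_shift m. block (- int k) (2 * k + 1) x \<in> B}"

definition cylinders :: "nat \<Rightarrow> (int \<Rightarrow> letter) set set" where
  "cylinders m = {cylinder m k B | k B. True}"

lemma take_drop_block:
  "d + n \<le> N \<Longrightarrow> take n (drop d (block i N x)) = block (i + int d) n x"
  by (rule nth_equalityI) (auto simp: add_ac)

lemma block_subblock:
  "k \<le> k' \<Longrightarrow> take (2 * k + 1) (drop (k' - k) (block (- int k') (2 * k' + 1) x)) = block (- int k) (2 * k + 1) x"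
  by (subst take_drop_block) (auto simp: of_nat_diff)

lemma cylinder_refine:
  assumes "k \<le> k'"
  shows "cylinder m k B = cylinder m k' {w. take (2 * k + 1) (drop (k' - k) w) \<in> B}"
  unfolding cylinder_def by (simp only: block_subblock[OF assms] mem_Collect_eq)

lemma block_preimage_sets: "{x \<in> dyck_shift m. block i n x \<in> B} \<in> sets (mu_tilde m)"
proof -
  have "{x \<in> dyck_shift m. block i n x \<in> B} = block i n -` B \<inter> space (mu_tilde m)"
    by (auto simp: space_mu_tilde)
  then show ?thesis using simple_functionD(2)[OF simple_function_block] by simp
qed

lemma algebra_cylinders: "algebra (dyck_shift m) (cylinders m)"
  unfolding algebra_iff_Int
proof (intro conjI ballI)
  show "cylinders m \<subseteq> Pow (dyck_shift m)" by (auto simp: cylinders_def cylinder_def)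
  have "{} = cylinder m 0 {}" by (simp add: cylinder_def)
  then show "{} \<in> cylinders m" unfolding cylinders_def by blast
next
  fix a assume "a \<in> cylinders m"
  then obtain k B where "a = cylinder m k B" unfolding cylinders_def by blast
  then have "dyck_shift m - a = cylinder m k (- B)" by (auto simp: cylinder_def)
  then show "dyck_shift m - a \<in> cylinders m" unfolding cylinders_def by blast
next
  fix a b assume "a \<in> cylinders m" "b \<in> cylinders m"
  then obtain k B k' B' where "a = cylinder m k B" "b = cylinder m k' B'" unfolding cylinders_def by blast
  moreover define K where "K = max k k'"
  ultimately obtain C C' where "a = cylinder m K C" "b = cylinder m K C'"
    using cylinder_refine[of k K] cylinder_refine[of k' K] by (metis max.cobounded1 max.cobounded2)
  then have "a \<inter> b = cylinder m K (C \<inter> C')" by (auto simp: cylinder_def)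
  then show "a \<inter> b \<in> cylinders m" unfolding cylinders_def by blast
qed

lemma sets_mu_tilde_cylinders: "sets (mu_tilde m) = sigma_sets (dyck_shift m) (cylinders m)"
proof
  have "cylinders m \<subseteq> sets (mu_tilde m)"
    using block_preimage_sets by (auto simp: cylinders_def cylinder_def)
  then show "sigma_sets (dyck_shift m) (cylinders m) \<subseteq> sets (mu_tilde m)"
    using sets.sigma_sets_subset[of "cylinders m" "mu_tilde m"] by (simp add: space_mu_tilde)
next
  let ?S = "sigma (dyck_shift m) (cylinders m)"
  have pow: "cylinders m \<subseteq> Pow (dyck_shift m)" by (auto simp: cylinders_def cylinder_def)
  have sp: "space ?S = dyck_shift m" and st: "sets ?S = sigma_sets (dyck_shift m) (cylinders m)"
    using pow by simp_all
  \<comment> \<open>Measurability of the identity says that every set of \<open>dyck_space\<close>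
    is generated by cylinders.\<close>
  have id: "(\<lambda>x. x) \<in> measurable ?S (dyck_space m)"
    unfolding dyck_space_def
  proof (rule measurable_restrict_space2)
    have "(\<lambda>x i. x i) \<in> measurable ?S (PiM UNIV (\<lambda>_. count_space (alphabet m)))"
    proof (rule measurable_PiM_single')
      fix i :: int
      have alphabet: "(\<lambda>x. x i) \<in> dyck_shift m \<rightarrow> alphabet m" by (simp add: dyck_shift_def)
      have "(\<lambda>x. x i) -` {c} \<inter> space ?S \<in> sets ?S" for c
      proof -
        \<comment> \<open>The window of radius |i| contains i, at list index i + |i|.\<close>
        have "(\<lambda>x. x i) -` {c} \<inter> space ?S = cylinder m (nat \<bar>i\<bar>) {w. w ! nat (i + \<bar>i\<bar>) = c}"
          unfolding sp cylinder_def by (auto simp: nat_less_iff)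
        also have "\<dots> \<in> cylinders m" unfolding cylinders_def by blast
        finally show ?thesis unfolding st by (rule sigma_sets.Basic)
      qed
      then show "(\<lambda>x. x i) \<in> measurable ?S (count_space (alphabet m))"
        using alphabet by (subst measurable_count_space_eq2[OF finite_alphabet]) (simp add: sp)
    next
      show "(\<lambda>x i. x i) \<in> space ?S \<rightarrow> (\<Pi>\<^sub>E i\<in>UNIV. space (count_space (alphabet m)))"
        unfolding sp by (auto simp: dyck_shift_def PiE_def)
    qed
    then show "(\<lambda>x. x) \<in> measurable ?S (PiM UNIV (\<lambda>_. count_space (alphabet m)))" by simp
  qed (simp add: sp)
  have "A \<in> sets ?S" if "A \<in> sets (dyck_space m)" for A
    using measurable_sets[OF id that] sets.sets_into_space[OF that] by (simp add: sp space_dyck_space Int_absorb2)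
  then show "sets (mu_tilde m) \<subseteq> sigma_sets (dyck_shift m) (cylinders m)"
    by (auto simp: sets_mu_tilde st)
qed

lemma emeasure_block_mem:
  assumes m: "m \<ge> 1"
  shows "emeasure (mu_tilde m) {x \<in> dyck_shift m. block i n x \<in> B}
    = (\<Sum>w\<in>B \<inter> {w. set w \<subseteq> alphabet m \<and> length w = n}. ennreal (word_weight m w / 2 ^ n))"
proof -
  let ?W = "B \<inter> {w. set w \<subseteq> alphabet m \<and> length w = n}"
  let ?F = "\<lambda>w. {x \<in> dyck_shift m. block i n x = w}"
  have fin: "finite ?W" using finite_lists_length_eq[OF finite_alphabet] by blast
  have "set (block i n x) \<subseteq> alphabet m" if "x \<in> dyck_shift m" for x
    using block_in_lists[OF that, of i n] by auto
  then have "{x \<in> dyck_shift m. block i n x \<in> B} = (\<Union>w\<in>?W. ?F w)"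
    by auto
  also have "emeasure (mu_tilde m) \<dots> = (\<Sum>w\<in>?W. emeasure (mu_tilde m) (?F w))"
    by (rule sum_emeasure[symmetric])
      (use block_sets fin in \<open>auto simp: disjoint_family_on_def\<close>)
  also have "\<dots> = (\<Sum>w\<in>?W. ennreal (word_weight m w / 2 ^ n))"
  proof (rule sum.cong)
    fix w assume "w \<in> ?W"
    then have "w \<in> lists (alphabet m)" "length w = n" by auto
    then show "emeasure (mu_tilde m) (?F w) = ennreal (word_weight m w / 2 ^ n)"
      using emeasure_block[OF m, of w i] by simp
  qed simp
  finally show ?thesis .
qed

lemma block_seq_shift: "block i n (seq_shift x) = block (i + 1) n x"
  by (simp add: block_def seq_shift_def add_ac)

lemma seq_shift_dyck_shift:
  assumes "x \<in> dyck_shift m"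
  shows "seq_shift x \<in> dyck_shift m"
proof -
  have map: "map (seq_shift x) [r..l] = map x [r + 1..l + 1]" for r l
    by (rule nth_equalityI) (auto simp: seq_shift_def add_ac)
  show ?thesis
    using assms unfolding dyck_shift_def mem_Collect_eq map by (simp add: seq_shift_def)
qed

lemma seq_shift_preimage:
  "seq_shift -` cylinder m k B \<inter> dyck_shift m = {x \<in> dyck_shift m. block (1 - int k) (2 * k + 1) x \<in> B}"
  using seq_shift_dyck_shift by (auto simp: cylinder_def block_seq_shift)

lemma measurable_seq_shift: "seq_shift \<in> measurable (mu_tilde m) (mu_tilde m)"
proof (rule measurable_sigma_sets[OF sets_mu_tilde_cylinders])
  show "cylinders m \<subseteq> Pow (dyck_shift m)" by (auto simp: cylinders_def cylinder_def)
  show "seq_shift \<in> space (mu_tilde m) \<rightarrow> dyck_shift m"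
    using seq_shift_dyck_shift by (simp add: space_mu_tilde)
  show "seq_shift -` C \<inter> space (mu_tilde m) \<in> sets (mu_tilde m)" if "C \<in> cylinders m" for C
    using that seq_shift_preimage block_preimage_sets by (auto simp: cylinders_def space_mu_tilde)
qed

text \<open>Cylinders are an intersection-stable generator, and the preimage of one is the same
  block condition one place to the right, of equal probability by
  \<open>emeasure_block_mem\<close>.\<close>

lemma mu_tilde_invariant:
  assumes m: "m \<ge> 1"
  shows "distr (mu_tilde m) (mu_tilde m) seq_shift = mu_tilde m"
proof (rule measure_eqI_generator_eq)
  interpret prob_space "mu_tilde m" by (rule prob_space_mu_tilde[OF m])
  show "Int_stable (cylinders m)"
    using algebra_cylinders[of m] unfolding algebra_iff_Int Int_stable_def by blast
  show "cylinders m \<subseteq> Pow (dyck_shift m)" by (auto simp: cylinders_def cylinder_def)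
  show "sets (distr (mu_tilde m) (mu_tilde m) seq_shift) = sigma_sets (dyck_shift m) (cylinders m)"
    "sets (mu_tilde m) = sigma_sets (dyck_shift m) (cylinders m)"
    by (simp_all add: sets_mu_tilde_cylinders)
  have "dyck_shift m = cylinder m 0 UNIV" by (simp add: cylinder_def)
  then show "range (\<lambda>_::nat. dyck_shift m) \<subseteq> cylinders m" unfolding cylinders_def by blast
  show "(\<Union>_::nat. dyck_shift m) = dyck_shift m" by simp
  show "emeasure (distr (mu_tilde m) (mu_tilde m) seq_shift) (dyck_shift m) \<noteq> \<infinity>"
    using sets.top[of "mu_tilde m"]
    by (subst emeasure_distr[OF measurable_seq_shift]) (simp_all add: space_mu_tilde)
  fix C assume "C \<in> cylinders m"
  then obtain k B where C: "C = cylinder m k B" unfolding cylinders_def by blast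
  have "emeasure (distr (mu_tilde m) (mu_tilde m) seq_shift) C
      = emeasure (mu_tilde m) {x \<in> dyck_shift m. block (1 - int k) (2 * k + 1) x \<in> B}"
    using \<open>C \<in> cylinders m\<close> unfolding C
    by (subst emeasure_distr[OF measurable_seq_shift])
      (auto simp: sets_mu_tilde_cylinders space_mu_tilde seq_shift_preimage)
  also have "\<dots> = emeasure (mu_tilde m) C"
    unfolding C cylinder_def emeasure_block_mem[OF m] ..
  finally show "emeasure (distr (mu_tilde m) (mu_tilde m) seq_shift) C = emeasure (mu_tilde m) C" .
qed

section \<open>Approximation of measurable sets by a generating algebra\<close>

lemma (in prob_space) algebra_approximation:
  assumes alg: "algebra (space M) \<A>" and gen: "sets M = sigma_sets (space M) \<A>"
    and A: "A \<in> sets M" and e: "e > (0 :: real)"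
  shows "\<exists>B\<in>\<A>. prob (sym_diff A B) < e"
proof -
  interpret algebra "space M" \<A> by (rule alg)
  have sets: "B \<in> sets M" if "B \<in> \<A>" for B
    using that gen by (auto intro: sigma_sets.Basic)
  have "A \<in> sigma_sets (space M) \<A>" using A gen by simp
  then show ?thesis using e
  proof (induction arbitrary: e)
    case (Basic A)
    then show ?case by (intro bexI[of _ A]) auto
  next
    case Empty
    then show ?case by (intro bexI[of _ "{}"]) auto
  next
    case (Compl A)
    then obtain B where B: "B \<in> \<A>" "prob (sym_diff A B) < e" by blast
    have "A \<subseteq> space M" using Compl.hyps sigma_sets_into_sp[OF space_closed] by blast
    then have "sym_diff (space M - A) (space M - B) = sym_diff A B"
      using sets[OF B(1)] sets.sets_into_space by blast
    then show ?case using B by (intro bexI[of _ "space M - B"]) auto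
  next
    case (Union a)
    have a: "a i \<in> sets M" for i using Union.hyps gen by simp
    let ?U = "\<lambda>n. \<Union>i<n. a i"
    have "(\<lambda>n. prob (?U n)) \<longlonglongrightarrow> prob (\<Union>n. ?U n)"
    proof (rule finite_Lim_measure_incseq)
      show "range ?U \<subseteq> sets M" using a by auto
      show "incseq ?U" by (intro monoI UN_mono) auto
    qed
    moreover have "(\<Union>n. ?U n) = (\<Union>i. a i)" by auto
    ultimately have "(\<lambda>n. prob (?U n)) \<longlonglongrightarrow> prob (\<Union>i. a i)" by simp
    from LIMSEQ_D[OF this, of "e / 2"] Union.prems
    obtain N where N: "\<bar>prob (?U N) - prob (\<Union>i. a i)\<bar> < e / 2" by auto
    \<comment> \<open>N approximants with this tolerance cost at most e / 2 together; the other half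
      of e pays for cutting the union off at N. The summand 1 covers N = 0.\<close>
    have "\<forall>i. \<exists>B. B \<in> \<A> \<and> prob (sym_diff (a i) B) < e / (2 * (real N + 1))"
      using Union.IH Union.prems by (simp add: Bex_def)
    then obtain B where B: "\<And>i. B i \<in> \<A>" "\<And>i. prob (sym_diff (a i) (B i)) < e / (2 * (real N + 1))"
      by metis
    let ?B = "\<Union>i<N. B i"
    have "prob (sym_diff (\<Union>i. a i) ?B)
        \<le> prob (((\<Union>i. a i) - ?U N) \<union> (\<Union>i<N. sym_diff (a i) (B i)))"
      using a sets[OF B(1)] by (intro finite_measure_mono) auto
    also have "\<dots> \<le> prob ((\<Union>i. a i) - ?U N) + prob (\<Union>i<N. sym_diff (a i) (B i))"
      using a sets[OF B(1)] by (intro measure_Un_le) auto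
    also have "prob ((\<Union>i. a i) - ?U N) = prob (\<Union>i. a i) - prob (?U N)"
      using a by (intro finite_measure_Diff) auto
    also have "prob (\<Union>i<N. sym_diff (a i) (B i)) \<le> (\<Sum>i<N. prob (sym_diff (a i) (B i)))"
      using a sets[OF B(1)] by (intro finite_measure_subadditive_finite) auto
    also have "\<dots> \<le> (\<Sum>i<N. e / (2 * (real N + 1)))"
      using B(2) by (intro sum_mono) (simp add: less_imp_le)
    also have "\<dots> \<le> e / 2" using Union.prems by (simp add: field_simps)
    finally have "prob (sym_diff (\<Union>i. a i) ?B) < e" using N by linarith
    moreover have "?B \<in> \<A>" using B(1) by (intro finite_UN) auto
    ultimately show ?case by blast
  qed
qed

section \<open>The entropy of blocks\<close>

lemma sum_lists_Suc:
  fixes f :: "bool list \<Rightarrow> real"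
  shows "(\<Sum>bs | length bs = Suc n. f bs)
    = (\<Sum>bs | length bs = n. f (True # bs) + f (False # bs))"
proof -
  have fin: "finite {bs :: bool list. length bs = n}"
    using finite_lists_length_eq[of "UNIV :: bool set" n] by simp
  have "{bs :: bool list. length bs = Suc n} = (#) True ` {bs. length bs = n} \<union> (#) False ` {bs. length bs = n}"
    (is "?L = ?R")
  proof (rule set_eqI)
    show "bs \<in> ?L \<longleftrightarrow> bs \<in> ?R" for bs by (cases bs; cases "hd bs") auto
  qed
  then have "(\<Sum>bs | length bs = Suc n. f bs)
      = sum f ((#) True ` {bs. length bs = n}) + sum f ((#) False ` {bs. length bs = n})"
    using fin by (simp only:, intro sum.union_disjoint) auto
  then show ?thesis by (simp add: sum.reindex sum.distrib)
qed

lemma card_bool_lists: "card {bs :: bool list. length bs = n} = 2 ^ n"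
  using card_lists_length_eq[of "UNIV :: bool set" n] by simp

text \<open>Second moment of a walk reflected at 0: (d + 1)^2 + (d - 1)^2 = 2 d^2 + 2, and the
  boundary d = 0 gives less, so the mean square grows by at most 1 per step.\<close>

lemma sum_depth_squared: "(\<Sum>bs | length bs = n. (real (depth bs))\<^sup>2) \<le> real n * 2 ^ n"
proof (induction n)
  case (Suc n)
  have step: "(real (depth (True # bs)))\<^sup>2 + (real (depth (False # bs)))\<^sup>2 \<le> 2 * (real (depth bs))\<^sup>2 + 2" for bs
    by (cases "depth bs") (simp_all add: power2_eq_square algebra_simps)
  have "(\<Sum>bs | length bs = Suc n. (real (depth bs))\<^sup>2)
      \<le> (\<Sum>bs | length bs = n. 2 * (real (depth bs))\<^sup>2 + 2)"
    unfolding sum_lists_Suc by (intro sum_mono step)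
  also have "\<dots> = 2 * (\<Sum>bs | length bs = n. (real (depth bs))\<^sup>2) + 2 * 2 ^ n"
    by (simp add: sum.distrib sum_distrib_left card_bool_lists)
  also have "\<dots> \<le> 2 * (real n * 2 ^ n) + 2 * 2 ^ n" using Suc by simp
  finally show ?case by (simp add: algebra_simps)
qed simp

lemma sum_depth_le: "(\<Sum>bs | length bs = n. real (depth bs)) \<le> sqrt (real n) * 2 ^ n"
proof (cases "n = 0")
  case False
  then have pos: "sqrt (real n) > 0" by simp
  \<comment> \<open>The weight sqrt n balances the two terms on the right, each of average at most
    n.\<close>
  have "2 * sqrt (real n) * real (depth bs) \<le> (real (depth bs))\<^sup>2 + real n" for bs
    using sum_squares_bound[of "sqrt (real n)" "real (depth bs)"] by simp
  then have "(\<Sum>bs | length bs = n. 2 * sqrt (real n) * real (depth bs))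
      \<le> (\<Sum>bs | length bs = n. (real (depth bs))\<^sup>2 + real n)"
    by (intro sum_mono)
  also have "\<dots> \<le> 2 * (real n * 2 ^ n)"
    using sum_depth_squared[of n] by (simp add: sum.distrib card_bool_lists)
  also have "\<dots> = 2 * sqrt (real n) * (sqrt (real n) * 2 ^ n)" by simp
  finally have "2 * sqrt (real n) * (\<Sum>bs | length bs = n. real (depth bs))
      \<le> 2 * sqrt (real n) * (sqrt (real n) * 2 ^ n)"
    by (simp add: sum_distrib_left)
  then show ?thesis using pos by simp
qed simp

text \<open>A \<beta> that closes an \<alpha> of the block adds no cell: the number of \<beta> rises
  by one as the depth falls by one.\<close>

lemma cells_eq: "cells bs = length (filter Not bs) + depth bs"
  by (induction bs) auto

lemma sum_filter_Not: "(\<Sum>bs | length bs = n. real (length (filter Not bs))) = real n / 2 * 2 ^ n"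
  by (induction n) (simp_all add: sum_lists_Suc sum.distrib card_bool_lists field_simps
      flip: sum_distrib_left)

definition mean_cells :: "nat \<Rightarrow> real" where
  "mean_cells n = (\<Sum>bs | length bs = n. real (cells bs)) / 2 ^ n"

lemma mean_cells_bounds: "real n / 2 \<le> mean_cells n" "mean_cells n \<le> real n / 2 + sqrt (real n)"
proof -
  have eq: "mean_cells n = real n / 2 + (\<Sum>bs | length bs = n. real (depth bs)) / 2 ^ n"
    by (simp add: mean_cells_def cells_eq sum.distrib sum_filter_Not add_divide_distrib)
  show "real n / 2 \<le> mean_cells n" unfolding eq by (simp add: sum_nonneg)
  show "mean_cells n \<le> real n / 2 + sqrt (real n)"
    unfolding eq using sum_depth_le[of n] by (simp add: field_simps)
qed

text \<open>The information of a word of positive probability depends on its bits only and is affine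
  in \<open>cells\<close>, so the entropy is an average over uniform bit strings.\<close>

lemma rv_entropy_block:
  assumes m: "m \<ge> 1"
  shows "rv_entropy (mu_tilde m) (block i n) = real n * ln 2 + mean_cells n * ln (real m)"
proof -
  interpret prob_space "mu_tilde m" by (rule prob_space_mu_tilde[OF m])
  let ?X = "block i n" and ?M = "mu_tilde m"
  let ?p = "\<lambda>w. prob {x \<in> space ?M. ?X x = w}"
  have X: "simple_function ?M ?X" by (rule simple_function_block)
  \<comment> \<open>Multiplying by the probability keeps the identity valid when that probability is
    0.\<close>
  have ln_p: "?p w * ln (?p w) = - (real n * ln 2 + real (cells (word_bits w)) * ln (real m)) * ?p w"
    if "w \<in> ?X ` space ?M" for w
  proof -
    have w: "w \<in> lists (alphabet m)" "length w = n"
      using that block_in_lists unfolding space_mu_tilde by (blast, auto)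
    have p: "?p w = word_weight m w / 2 ^ n"
      using emeasure_block[OF m w(1), of i] w(2)
      by (simp add: space_mu_tilde emeasure_eq_measure word_weight_def)
    show ?thesis
    proof (cases "word_weight m w = 0")
      case False
      then have "ln (?p w) = - (real n * ln 2 + real (cells (word_bits w)) * ln (real m))"
        unfolding p word_weight_def using m
        by (auto simp: ln_div ln_mult ln_realpow power_one_over split: if_splits)
      then show ?thesis by simp
    qed (simp add: p)
  qed
  let ?b = "\<lambda>x. word_bits (?X x)"
  have b: "simple_function ?M ?b" by (rule simple_function_compose1[OF X])
  have pb: "prob {x \<in> space ?M. ?b x = bs} = 1 / 2 ^ n" if "length bs = n" for bs
    using emeasure_word_bits[OF m that, of i] by (simp add: space_mu_tilde emeasure_eq_measure)
  have range: "?b ` space ?M = {bs. length bs = n}"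
  proof (intro equalityI subsetI)
    fix bs :: "bool list" assume "bs \<in> {bs. length bs = n}"
    then have "prob {x \<in> space ?M. ?b x = bs} \<noteq> 0" using pb by simp
    then have "{x \<in> space ?M. ?b x = bs} \<noteq> {}" by (metis measure_empty)
    then show "bs \<in> ?b ` space ?M" by blast
  qed (auto simp: word_bits_def)
  have "rv_entropy ?M ?X
      = (\<Sum>w\<in>?X ` space ?M. (real n * ln 2 + real (cells (word_bits w)) * ln (real m)) * ?p w)"
    unfolding rv_entropy_eq_sum[OF X] sum_negf[symmetric]
    by (intro sum.cong HOL.refl) (simp add: ln_p algebra_simps)
  \<comment> \<open>Passing through the integral exchanges the sum over words for a sum over their
    bits.\<close>
  also have "\<dots> = (\<integral>x. real n * ln 2 + real (cells (?b x)) * ln (real m) \<partial>?M)"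
    by (rule integral_simple[OF X, symmetric])
  also have "\<dots> = (\<Sum>bs\<in>?b ` space ?M. (real n * ln 2 + real (cells bs) * ln (real m))
      * prob {x \<in> space ?M. ?b x = bs})"
    by (rule integral_simple[OF b])
  also have "\<dots> = (\<Sum>bs | length bs = n. (real n * ln 2 + real (cells bs) * ln (real m)) * (1 / 2 ^ n))"
    unfolding range by (intro sum.cong) (simp_all add: pb)
  also have "\<dots> = real n * ln 2 + mean_cells n * ln (real m)"
    by (simp add: mean_cells_def sum.distrib add_divide_distrib card_bool_lists
        flip: sum_divide_distrib sum_distrib_right)
  finally show ?thesis .
qed

text \<open>The margin changes the length by a constant and the depth contributes O(sqrt n), so
  neither survives division by n.\<close>

lemma rv_entropy_block_tendsto:
  assumes m: "m \<ge> 1"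
  shows "(\<lambda>n. rv_entropy (mu_tilde m) (block i (n + 2 * k)) / real n) \<longlonglongrightarrow> ln 2 + 1 / 2 * ln (real m)"
proof (rule tendsto_sandwich)
  have lnm: "ln (real m) \<ge> 0" using m by simp
  let ?lo = "\<lambda>n. ((real n + 2 * real k) * ln 2 + (real n + 2 * real k) / 2 * ln (real m)) / real n"
  let ?hi = "\<lambda>n. ((real n + 2 * real k) * ln 2
    + ((real n + 2 * real k) / 2 + sqrt (real n + 2 * real k)) * ln (real m)) / real n"
  show "eventually (\<lambda>n. ?lo n \<le> rv_entropy (mu_tilde m) (block i (n + 2 * k)) / real n) sequentially"
    unfolding rv_entropy_block[OF m]
    using mean_cells_bounds(1)[of "_ + 2 * k"] lnm
    by (intro always_eventually allI divide_right_mono add_mono mult_right_mono) (auto simp: algebra_simps)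
  show "eventually (\<lambda>n. rv_entropy (mu_tilde m) (block i (n + 2 * k)) / real n \<le> ?hi n) sequentially"
    unfolding rv_entropy_block[OF m]
    using mean_cells_bounds(2)[of "_ + 2 * k"] lnm
    by (intro always_eventually allI divide_right_mono add_mono mult_right_mono) (auto simp: algebra_simps)
  show "?lo \<longlonglongrightarrow> ln 2 + 1 / 2 * ln (real m)" by real_asymp
  show "?hi \<longlonglongrightarrow> ln 2 + 1 / 2 * ln (real m)" by real_asymp
qed

section \<open>The entropy of the shift\<close>

lemma funpow_seq_shift: "(seq_shift ^^ i) x n = x (n + int i)"
  by (induction i arbitrary: n) (simp_all add: seq_shift_def add_ac)

text \<open>Outside the symmetric differences between the cells and their approximating cylinders,
  the block of a point lies in the cylinder of its own cell and in no other, so choosing any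
  admissible cell is correct.\<close>

lemma partition_block_approximation:
  assumes m: "m \<ge> 1" and P: "finite_measurable_partition (mu_tilde m) P" and e: "e > 0"
  shows "\<exists>k \<psi>. measure (mu_tilde m)
    {x \<in> space (mu_tilde m). part_label P x \<noteq> \<psi> (block (- int k) (2 * k + 1) x)} < e"
proof -
  interpret prob_space "mu_tilde m" by (rule prob_space_mu_tilde[OF m])
  have fin: "finite P" and meas: "P \<subseteq> sets (mu_tilde m)" and part: "partition_on (dyck_shift m) P"
    using P by (auto simp: finite_measurable_partition_def space_mu_tilde)
  define d where "d = e / (real (card P) + 1)"
  have d: "d > 0" using e by (simp add: d_def)
  have "\<exists>k B. prob (sym_diff A (cylinder m k B)) < d" if "A \<in> P" for A
  proof -
    have "\<exists>C\<in>cylinders m. prob (sym_diff A C) < d"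
      using algebra_approximation[of "cylinders m" A d] algebra_cylinders[of m] sets_mu_tilde_cylinders[of m]
        that meas d by (auto simp: space_mu_tilde)
    then show ?thesis unfolding cylinders_def by blast
  qed
  then obtain k B where kB: "\<And>A. A \<in> P \<Longrightarrow> prob (sym_diff A (cylinder m (k A) (B A))) < d" by metis
  \<comment> \<open>A common radius, so that one block decides membership in all the
    cylinders.\<close>
  define K where "K = Max (k ` P)"
  define C where "C A = {w. take (2 * k A + 1) (drop (K - k A) w) \<in> B A}" for A
  have C: "cylinder m (k A) (B A) = cylinder m K (C A)" if "A \<in> P" for A
    unfolding C_def K_def using that fin by (intro cylinder_refine) auto
  define \<psi> where "\<psi> w = (SOME A. A \<in> P \<and> w \<in> C A)" for w
  let ?E = "{x \<in> space (mu_tilde m). part_label P x \<noteq> \<psi> (block (- int K) (2 * K + 1) x)}"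
  have "?E \<subseteq> (\<Union>A\<in>P. sym_diff A (cylinder m K (C A)))"
  proof (rule subsetI, rule ccontr)
    fix x assume "x \<in> ?E" and no: "x \<notin> (\<Union>A\<in>P. sym_diff A (cylinder m K (C A)))"
    let ?w = "block (- int K) (2 * K + 1) x"
    have x: "x \<in> dyck_shift m" and neq: "part_label P x \<noteq> \<psi> ?w"
      using \<open>x \<in> ?E\<close> by (auto simp: space_mu_tilde)
    have iff: "x \<in> A \<longleftrightarrow> ?w \<in> C A" if "A \<in> P" for A
      using no that x by (auto simp: cylinder_def)
    have "part_label P x \<in> P \<and> ?w \<in> C (part_label P x)"
      using part_label[OF part x] iff by blast
    then have "\<psi> ?w \<in> P \<and> ?w \<in> C (\<psi> ?w)" unfolding \<psi>_def by (rule someI)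
    then have "part_label P x = \<psi> ?w" using iff by (intro part_label_eqI[OF part]) auto
    with neq show False by simp
  qed
  moreover have sets: "sym_diff A (cylinder m K (C A)) \<in> sets (mu_tilde m)" if "A \<in> P" for A
    using that meas block_preimage_sets[of m] by (auto simp: cylinder_def)
  ultimately have "prob ?E \<le> prob (\<Union>A\<in>P. sym_diff A (cylinder m K (C A)))"
    using fin by (intro finite_measure_mono) auto
  also have "\<dots> \<le> (\<Sum>A\<in>P. prob (sym_diff A (cylinder m K (C A))))"
    using sets fin by (intro finite_measure_subadditive_finite) auto
  also have "\<dots> \<le> (\<Sum>A\<in>P. d)"
    using kB C by (intro sum_mono less_imp_le) force
  also have "\<dots> < e" using e by (simp add: d_def field_simps)
  finally show ?thesis by blast
qed

definition letter_partition :: "nat \<Rightarrow> (int \<Rightarrow> letter) set set" where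
  "letter_partition m = (\<lambda>c. {x \<in> dyck_shift m. x 0 = c}) ` alphabet m - {{}}"

lemma letter_partition: "finite_measurable_partition (mu_tilde m) (letter_partition m)"
  unfolding finite_measurable_partition_def
proof (intro conjI)
  show "finite (letter_partition m)" by (simp add: letter_partition_def finite_alphabet)
  have "{x \<in> dyck_shift m. x 0 = c} = {x \<in> dyck_shift m. block 0 1 x = [c]}" for c
    by (simp add: block_def)
  then show "letter_partition m \<subseteq> sets (mu_tilde m)"
    using block_sets by (auto simp: letter_partition_def)
  show "partition_on (space (mu_tilde m)) (letter_partition m)"
    by (rule partition_onI) (auto simp: letter_partition_def space_mu_tilde disjnt_def dyck_shift_def)
qed

lemma part_label_letter_partition:
  assumes "x \<in> dyck_shift m"
  shows "part_label (letter_partition m) x = {y \<in> dyck_shift m. y 0 = x 0}"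
  using letter_partition[of m] assms
  by (intro part_label_eqI[of "space (mu_tilde m)"])
    (auto simp: finite_measurable_partition_def letter_partition_def dyck_shift_def)

theorem proposition3p5:
  fixes m :: nat
  assumes "m \<ge> 2"
  shows "ks_entropy (mu_tilde m) seq_shift = ereal (ln 2 + 1 / 2 * ln (real m))"
proof -
  have m: "m \<ge> 1" using assms by simp
  interpret prob_space "mu_tilde m" by (rule prob_space_mu_tilde[OF m])
  interpret measure_preserving "mu_tilde m" seq_shift
    by unfold_locales (rule measurable_seq_shift, rule mu_tilde_invariant[OF m])
  \<comment> \<open>This block contains the windows of radius k about 0, ..., n - 1; for k = 0 it
    consists of exactly the letters there.\<close>
  let ?B = "\<lambda>k n. block (- int k) (n + 2 * k) :: (int \<Rightarrow> letter) \<Rightarrow> letter list"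
  have Tn: "(seq_shift ^^ i) x \<in> dyck_shift m" if "x \<in> dyck_shift m" for i x
    using that seq_shift_dyck_shift by (induction i) auto
  show ?thesis
  proof (rule ks_entropy_generator[where B = ?B])
    show "simple_function (mu_tilde m) (?B k n)" for k n by (rule simple_function_block)
    show "(\<lambda>n. rv_entropy (mu_tilde m) (?B k n) / real n) \<longlonglongrightarrow> ln 2 + 1 / 2 * ln (real m)" for k
      by (rule rv_entropy_block_tendsto[OF m])
  next
    fix P :: "(int \<Rightarrow> letter) set set" and e :: real
    assume P: "finite_measurable_partition (mu_tilde m) P" and e: "e > 0"
    obtain k \<psi> where close: "prob {x \<in> space (mu_tilde m). part_label P x \<noteq> \<psi> (block (- int k) (2 * k + 1) x)} < e"
      using partition_block_approximation[OF m P e] by blast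
    let ?g = "\<lambda>x. \<psi> (block (- int k) (2 * k + 1) x)"
    have "\<exists>\<phi>. \<forall>x\<in>space (mu_tilde m). ?g ((seq_shift ^^ i) x) = \<phi> (?B k n x)" if "i < n" for n i
    proof (intro exI ballI)
      fix x :: "int \<Rightarrow> letter"
      have "block (- int k) (2 * k + 1) ((seq_shift ^^ i) x) = block (- int k + int i) (2 * k + 1) x"
        by (simp add: block_def funpow_seq_shift algebra_simps)
      also have "\<dots> = take (2 * k + 1) (drop i (?B k n x))"
        using that by (intro take_drop_block[symmetric]) simp
      finally show "?g ((seq_shift ^^ i) x) = (\<lambda>w. \<psi> (take (2 * k + 1) (drop i w))) (?B k n x)" by simp
    qed
    moreover have "simple_function (mu_tilde m) ?g"
      by (rule simple_function_compose1[OF simple_function_block])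
    ultimately show "\<exists>k g. simple_function (mu_tilde m) g
        \<and> (\<forall>n. \<forall>i<n. \<exists>\<phi>. \<forall>x\<in>space (mu_tilde m). g ((seq_shift ^^ i) x) = \<phi> (?B k n x))
        \<and> prob {x \<in> space (mu_tilde m). part_label P x \<noteq> g x} < e"
      using close by blast
  next
    let ?Q = "letter_partition m"
    show "finite_measurable_partition (mu_tilde m) ?Q" by (rule letter_partition)
    fix n
    show "rv_entropy (mu_tilde m) (?B 0 n) \<le> rv_entropy (mu_tilde m) (itinerary seq_shift (part_label ?Q) n)"
    \<comment> \<open>All points of a cell share the letter at 0, so any chosen point of the cell
      reveals it.\<close>
    proof (rule rv_entropy_compose_le[where f = "map (\<lambda>A. (SOME y. y \<in> A) 0)"])
      show "simple_function (mu_tilde m) (itinerary seq_shift (part_label ?Q) n)"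
        by (intro simple_function_itinerary simple_function_part_label letter_partition measurable_seq_shift)
      fix x assume "x \<in> space (mu_tilde m)"
      then have x: "x \<in> dyck_shift m" by (simp add: space_mu_tilde)
      have "(SOME y. y \<in> part_label ?Q ((seq_shift ^^ i) x)) 0 = x (int i)" for i
      proof -
        have "(seq_shift ^^ i) x \<in> part_label ?Q ((seq_shift ^^ i) x)"
          using Tn[OF x] by (simp add: part_label_letter_partition)
        then have "(SOME y. y \<in> part_label ?Q ((seq_shift ^^ i) x)) \<in> part_label ?Q ((seq_shift ^^ i) x)"
          unfolding some_in_eq by blast
        then show ?thesis using Tn[OF x] by (simp add: part_label_letter_partition funpow_seq_shift)
      qed
      then show "?B 0 n x = map (\<lambda>A. (SOME y. y \<in> A) 0) (itinerary seq_shift (part_label ?Q) n x)"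
        by (simp add: block_def itinerary_def)
    qed
  qed
qed

end
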